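(* Let Assumption 2 (stated in the context) hold and let $\epsilon>0$. Let $\mathcal{C}_r\subseteq\mathcal{S}_r$ be a compact set and assume that for any $(x,u)\in\mathcal{C}_r$ there exists $q_{(x,u)}\in\mathbb{R}^m$ such that: (i) if $b(u)=0$, then $\nabla b(u)^\top q_{(x,u)}>0$; (ii) if $h_r(x,u)=0$, then $\frac{\partial h_r}{\partial u}(x,u)\,q_{(x,u)}+\frac{\partial h_r}{\partial x}(x,u)f(x,u)>0$. Then there exist $\alpha_f,\gamma_f>0$ such that, for all $\alpha>\alpha_f$ and $\gamma>\gamma_f$, the quadratic program (SGF) is feasible for every $(x,u)\in\mathcal{C}_r$, and moreover: if CRCQ holds for (SGF) at each $(x,u)\in\mathcal{C}_r$, then $g_{\epsilon,\alpha,\gamma}$ is locally Lipschitz in $\mathcal{C}_r$ and, consequently, the closed loop (SGF-CL) has a unique solution for every initial condition in $\mathcal{C}_r$.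
   Context: Conventions: for differentiable $g:\mathbb{R}^n\to\mathbb{R}^k$, $\frac{\partial g}{\partial x}\in\mathbb{R}^{k\times n}$ (so partial derivatives of scalar functions are row vectors); for scalar $g$, $\nabla g=(\frac{\partial g}{\partial x})^\top$. Plant: $\dot\xi=f(\xi,\upsilon)$ with $f:\mathbb{R}^n\times\mathbb{R}^m\to\mathbb{R}^n$. Assumption 1 (used to define $w$): for every constant input $\upsilon\equiv u$ the system has a unique globally exponentially stable equilibrium; it is denoted $w(u)$, giving a map $w:\mathbb{R}^m\to\mathbb{R}^n$ with $f(w(u),u)=0$. Data: $\Phi,h:\mathbb{R}^n\to\mathbb{R}$, $b:\mathbb{R}^m\to\mathbb{R}$. Fix $\beta>0$ and set $h_0(x,u)=h(x)$, $h_i(x,u)=\frac{\partial h_{i-1}}{\partial x}(x,u)f(x,u)+\beta h_{i-1}(x,u)$ for $i\ge1$. Let $\mathcal{S}=\{(x,u): h(x)\ge0,\ b(u)\ge0\}$ and $\mathcal{S}_i=\{(x,u): b(u)\ge0,\ h_i(x,u)\ge0\}$ for $i\ge0$, so $\mathcal{S}_0=\mathcal{S}$. Assumption 2: (1) there is an integer $r\ge1$ such that $f$ is $(r+1)$-times and $h$ is $(r+2)$-times continuously differentiable; $\mathcal{S}_r\ne\emptyset$; $\frac{\partial h_r}{\partial u}(x,u)\ne0$ for all $(x,u)\in\mathcal{S}_r$ with $h_r(x,u)=0$; and $\frac{\partial h_i}{\partial u}(x,u)=0$ for all $(x,u)\in\mathcal{S}_r$ and all $i<r$. (2) $b$ is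 twice continuously differentiable, and $b(u)=0$ implies $\nabla b(u)\neq0$ for all $(x,u)\in\mathcal{S}$. (3) $\Phi$ and $w$ are twice continuously differentiable. This fixes $r$. Quadratic program (SGF), with parameters $\epsilon,\alpha,\gamma>0$: for given $(x,u)$, minimize over $q\in\mathbb{R}^m$ the function $\frac12\|q+\epsilon\frac{\partial w}{\partial u}(u)^\top\nabla\Phi(x)\|^2$ subject to (c1) $\nabla b(u)^\top q+\alpha b(u)\ge0$ and (c2) $\frac{\partial h_r}{\partial x}(x,u)f(x,u)+\frac{\partial h_r}{\partial u}(x,u)q+\gamma h_r(x,u)\ge0$. When feasible, its unique minimizer is $g_{\epsilon,\alpha,\gamma}(x,u)$. Closed loop (SGF-CL): $\dot\xi=f(\xi,\upsilon)$, $\dot\upsilon=g_{\epsilon,\alpha,\gamma}(\xi,\upsilon)$. CRCQ (Constant Rank Constraint Qualification) for (SGF) at $(x,u)$: for every subset $\tilde J$ of the constraints among (c1), (c2) that are active (hold with equality) at $q=g_{\epsilon,\alpha,\gamma}(x,u)$, the family of the corresponding gradients with respect to $q$, namely $\nabla b(u')$ for (c1) and $\frac{\partial h_r}{\partial u}(x',u')^\top$ for (c2), has constant rank for $(x',u')$ in a neighborhood of $(x,u)$. *)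

theory Defs
  imports "HOL-Analysis.Analysis"
begin

text \<open>
  \<open>Ck k f\<close>: \<open>f\<close> is \<open>k\<close> times continuously differentiable on the whole space. The recursion is on
  directional derivatives because HOL has no recursion through the changing types of iterated
  Frechet derivatives.
\<close>

primrec Ck :: "nat \<Rightarrow> ('a::euclidean_space \<Rightarrow> 'b::euclidean_space) \<Rightarrow> bool" where
  "Ck 0 f \<longleftrightarrow> continuous_on UNIV f"
| "Ck (Suc k) f \<longleftrightarrow> (\<forall>x. f differentiable (at x)) \<and>
     (\<forall>v. Ck k (\<lambda>x. frechet_derivative f (at x) v))"

definition grad :: "(real^'n \<Rightarrow> real) \<Rightarrow> real^'n \<Rightarrow> real^'n" where
  "grad \<phi> x = (\<chi> i. frechet_derivative \<phi> (at x) (axis i 1))"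

text \<open>
  Partial derivatives of a scalar function with respect to state and input, as vectors; a row
  vector times a column vector is therefore written as an inner product.
\<close>

definition grad_x :: "((real^'n) \<times> (real^'m) \<Rightarrow> real) \<Rightarrow> (real^'n) \<times> (real^'m) \<Rightarrow> real^'n" where
  "grad_x \<phi> p = grad (\<lambda>x. \<phi> (x, snd p)) (fst p)"

definition grad_u :: "((real^'n) \<times> (real^'m) \<Rightarrow> real) \<Rightarrow> (real^'n) \<times> (real^'m) \<Rightarrow> real^'m" where
  "grad_u \<phi> p = grad (\<lambda>u. \<phi> (fst p, u)) (snd p)"

text \<open>
  Solutions on the time set \<open>I\<close> of an autonomous equation whose right-hand side \<open>F\<close> is defined
  only on \<open>D\<close>.
\<close>

definition ode_solution ::
  "('a::euclidean_space \<Rightarrow> 'a) \<Rightarrow> 'a set \<Rightarrow> real set \<Rightarrow> (real \<Rightarrow> 'a) \<Rightarrow> bool" where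
  "ode_solution F D I \<phi> \<longleftrightarrow>
     (\<forall>t\<in>I. \<phi> t \<in> D \<and> (\<phi> has_vector_derivative F (\<phi> t)) (at t within I))"

definition globally_exp_stable_equilibrium ::
  "('a::euclidean_space \<Rightarrow> 'a) \<Rightarrow> 'a \<Rightarrow> bool" where
  "globally_exp_stable_equilibrium F e \<longleftrightarrow>
     F e = 0 \<and>
     (\<forall>x0. \<exists>\<xi>. \<xi> 0 = x0 \<and> ode_solution F UNIV {0..} \<xi>) \<and>
     (\<exists>M>0. \<exists>\<kappa>>0. \<forall>\<xi>. ode_solution F UNIV {0..} \<xi> \<longrightarrow>
        (\<forall>t\<ge>0. norm (\<xi> t - e) \<le> M * exp (- \<kappa> * t) * norm (\<xi> 0 - e)))"

primrec h_seq ::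
  "((real^'n) \<times> (real^'m) \<Rightarrow> real^'n) \<Rightarrow> (real^'n \<Rightarrow> real) \<Rightarrow> real \<Rightarrow> nat
    \<Rightarrow> (real^'n) \<times> (real^'m) \<Rightarrow> real" where
  "h_seq f h \<beta> 0 = (\<lambda>p. h (fst p))"
| "h_seq f h \<beta> (Suc i) =
     (\<lambda>p. grad_x (h_seq f h \<beta> i) p \<bullet> f p + \<beta> * h_seq f h \<beta> i p)"

definition safe_set ::
  "(real^'n \<Rightarrow> real) \<Rightarrow> (real^'m \<Rightarrow> real) \<Rightarrow> ((real^'n) \<times> (real^'m)) set" where
  "safe_set h b = {(x, u). h x \<ge> 0 \<and> b u \<ge> 0}"

definition safe_seq ::
  "((real^'n) \<times> (real^'m) \<Rightarrow> real^'n) \<Rightarrow> (real^'n \<Rightarrow> real) \<Rightarrow> real \<Rightarrow> (real^'m \<Rightarrow> real) \<Rightarrow> nat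
    \<Rightarrow> ((real^'n) \<times> (real^'m)) set" where
  "safe_seq f h \<beta> b i = {(x, u). b u \<ge> 0 \<and> h_seq f h \<beta> i (x, u) \<ge> 0}"

text \<open>\<open>Input_Con\<close> and \<open>State_Con\<close> are the constraints (c1) and (c2) of (SGF).\<close>

datatype sgf_con = Input_Con | State_Con

fun con_grad ::
  "((real^'n) \<times> (real^'m) \<Rightarrow> real^'n) \<Rightarrow> (real^'n \<Rightarrow> real) \<Rightarrow> real \<Rightarrow> nat \<Rightarrow> (real^'m \<Rightarrow> real)
    \<Rightarrow> (real^'n) \<times> (real^'m) \<Rightarrow> sgf_con \<Rightarrow> real^'m" where
  "con_grad f h \<beta> r b p Input_Con = grad b (snd p)"
| "con_grad f h \<beta> r b p State_Con = grad_u (h_seq f h \<beta> r) p"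

fun con_lhs ::
  "((real^'n) \<times> (real^'m) \<Rightarrow> real^'n) \<Rightarrow> (real^'n \<Rightarrow> real) \<Rightarrow> real \<Rightarrow> nat \<Rightarrow> (real^'m \<Rightarrow> real)
    \<Rightarrow> real \<Rightarrow> real \<Rightarrow> (real^'n) \<times> (real^'m) \<Rightarrow> sgf_con \<Rightarrow> real^'m \<Rightarrow> real" where
  "con_lhs f h \<beta> r b \<alpha> \<gamma> p Input_Con q = grad b (snd p) \<bullet> q + \<alpha> * b (snd p)"
| "con_lhs f h \<beta> r b \<alpha> \<gamma> p State_Con q =
     grad_x (h_seq f h \<beta> r) p \<bullet> f p + grad_u (h_seq f h \<beta> r) p \<bullet> q + \<gamma> * h_seq f h \<beta> r p"

definition sgf_feasible_set ::
  "((real^'n) \<times> (real^'m) \<Rightarrow> real^'n) \<Rightarrow> (real^'n \<Rightarrow> real) \<Rightarrow> real \<Rightarrow> nat \<Rightarrow> (real^'m \<Rightarrow> real)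
    \<Rightarrow> real \<Rightarrow> real \<Rightarrow> (real^'n) \<times> (real^'m) \<Rightarrow> (real^'m) set" where
  "sgf_feasible_set f h \<beta> r b \<alpha> \<gamma> p =
     {q. con_lhs f h \<beta> r b \<alpha> \<gamma> p Input_Con q \<ge> 0 \<and> con_lhs f h \<beta> r b \<alpha> \<gamma> p State_Con q \<ge> 0}"

definition sgf_feasible ::
  "((real^'n) \<times> (real^'m) \<Rightarrow> real^'n) \<Rightarrow> (real^'n \<Rightarrow> real) \<Rightarrow> real \<Rightarrow> nat \<Rightarrow> (real^'m \<Rightarrow> real)
    \<Rightarrow> real \<Rightarrow> real \<Rightarrow> (real^'n) \<times> (real^'m) \<Rightarrow> bool" where
  "sgf_feasible f h \<beta> r b \<alpha> \<gamma> p \<longleftrightarrow> sgf_feasible_set f h \<beta> r b \<alpha> \<gamma> p \<noteq> {}"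

definition sgf_objective ::
  "(real^'n \<Rightarrow> real) \<Rightarrow> (real^'m \<Rightarrow> real^'n) \<Rightarrow> real \<Rightarrow> (real^'n) \<times> (real^'m) \<Rightarrow> real^'m \<Rightarrow> real" where
  "sgf_objective \<Phi> w \<epsilon> p q =
     1/2 * (norm (q + \<epsilon> *\<^sub>R (transpose (jacobian w (at (snd p))) *v grad \<Phi> (fst p))))\<^sup>2"

text \<open>Meaningful only at points where (SGF) is feasible.\<close>

definition sgf ::
  "((real^'n) \<times> (real^'m) \<Rightarrow> real^'n) \<Rightarrow> (real^'n \<Rightarrow> real) \<Rightarrow> real \<Rightarrow> nat \<Rightarrow> (real^'m \<Rightarrow> real)
    \<Rightarrow> (real^'n \<Rightarrow> real) \<Rightarrow> (real^'m \<Rightarrow> real^'n) \<Rightarrow> real \<Rightarrow> real \<Rightarrow> real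
    \<Rightarrow> (real^'n) \<times> (real^'m) \<Rightarrow> real^'m" where
  "sgf f h \<beta> r b \<Phi> w \<epsilon> \<alpha> \<gamma> p =
     (THE q. is_arg_min (sgf_objective \<Phi> w \<epsilon> p) (\<lambda>q. q \<in> sgf_feasible_set f h \<beta> r b \<alpha> \<gamma> p) q)"

definition sgf_crcq ::
  "((real^'n) \<times> (real^'m) \<Rightarrow> real^'n) \<Rightarrow> (real^'n \<Rightarrow> real) \<Rightarrow> real \<Rightarrow> nat \<Rightarrow> (real^'m \<Rightarrow> real)
    \<Rightarrow> (real^'n \<Rightarrow> real) \<Rightarrow> (real^'m \<Rightarrow> real^'n) \<Rightarrow> real \<Rightarrow> real \<Rightarrow> real
    \<Rightarrow> (real^'n) \<times> (real^'m) \<Rightarrow> bool" where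
  "sgf_crcq f h \<beta> r b \<Phi> w \<epsilon> \<alpha> \<gamma> p \<longleftrightarrow>
     (\<forall>J \<subseteq> {c. con_lhs f h \<beta> r b \<alpha> \<gamma> p c (sgf f h \<beta> r b \<Phi> w \<epsilon> \<alpha> \<gamma> p) = 0}.
        \<forall>\<^sub>F p' in nhds p. dim (con_grad f h \<beta> r b p' ` J) = dim (con_grad f h \<beta> r b p ` J))"

text \<open>
  Every point of \<open>C\<close> has a neighbourhood in the ambient space (not merely relative to \<open>C\<close>) on
  which (SGF) is feasible and its minimizer is Lipschitz.
\<close>

definition sgf_locally_lipschitz_in ::
  "((real^'n) \<times> (real^'m) \<Rightarrow> real^'n) \<Rightarrow> (real^'n \<Rightarrow> real) \<Rightarrow> real \<Rightarrow> nat \<Rightarrow> (real^'m \<Rightarrow> real)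
    \<Rightarrow> (real^'n \<Rightarrow> real) \<Rightarrow> (real^'m \<Rightarrow> real^'n) \<Rightarrow> real \<Rightarrow> real \<Rightarrow> real
    \<Rightarrow> ((real^'n) \<times> (real^'m)) set \<Rightarrow> bool" where
  "sgf_locally_lipschitz_in f h \<beta> r b \<Phi> w \<epsilon> \<alpha> \<gamma> C \<longleftrightarrow>
     (\<forall>p\<in>C. \<exists>\<delta>>0. (\<forall>p'\<in>ball p \<delta>. sgf_feasible f h \<beta> r b \<alpha> \<gamma> p') \<and>
        (\<exists>L. L-lipschitz_on (ball p \<delta>) (sgf f h \<beta> r b \<Phi> w \<epsilon> \<alpha> \<gamma>)))"

definition sgf_cl_solution ::
  "((real^'n) \<times> (real^'m) \<Rightarrow> real^'n) \<Rightarrow> (real^'n \<Rightarrow> real) \<Rightarrow> real \<Rightarrow> nat \<Rightarrow> (real^'m \<Rightarrow> real)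
    \<Rightarrow> (real^'n \<Rightarrow> real) \<Rightarrow> (real^'m \<Rightarrow> real^'n) \<Rightarrow> real \<Rightarrow> real \<Rightarrow> real
    \<Rightarrow> (real^'n) \<times> (real^'m) \<Rightarrow> real \<Rightarrow> (real \<Rightarrow> (real^'n) \<times> (real^'m)) \<Rightarrow> bool" where
  "sgf_cl_solution f h \<beta> r b \<Phi> w \<epsilon> \<alpha> \<gamma> p0 T \<phi> \<longleftrightarrow>
     \<phi> 0 = p0 \<and>
     ode_solution (\<lambda>p. (f p, sgf f h \<beta> r b \<Phi> w \<epsilon> \<alpha> \<gamma> p))
       {p. sgf_feasible f h \<beta> r b \<alpha> \<gamma> p} {0..<T} \<phi>"

text \<open>
  Existence and uniqueness in the Picard-Lindeloef sense: there is a solution on some \<open>[0, T)\<close>,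
  and every solution with the same initial condition, whatever its horizon, agrees with it on
  the common part of the two intervals.
\<close>

definition sgf_cl_unique_solution ::
  "((real^'n) \<times> (real^'m) \<Rightarrow> real^'n) \<Rightarrow> (real^'n \<Rightarrow> real) \<Rightarrow> real \<Rightarrow> nat \<Rightarrow> (real^'m \<Rightarrow> real)
    \<Rightarrow> (real^'n \<Rightarrow> real) \<Rightarrow> (real^'m \<Rightarrow> real^'n) \<Rightarrow> real \<Rightarrow> real \<Rightarrow> real
    \<Rightarrow> (real^'n) \<times> (real^'m) \<Rightarrow> bool" where
  "sgf_cl_unique_solution f h \<beta> r b \<Phi> w \<epsilon> \<alpha> \<gamma> p0 \<longleftrightarrow>
     (\<exists>T>0. \<exists>\<phi>. sgf_cl_solution f h \<beta> r b \<Phi> w \<epsilon> \<alpha> \<gamma> p0 T \<phi> \<and>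
        (\<forall>T' \<psi>. sgf_cl_solution f h \<beta> r b \<Phi> w \<epsilon> \<alpha> \<gamma> p0 T' \<psi> \<longrightarrow>
           (\<forall>t\<in>{0..<min T T'}. \<psi> t = \<phi> t)))"

end

theory Submission
  imports Defs
begin

text \<open>
  The minimizer of (SGF) is the Euclidean projection of
  \<open>d = - \<epsilon> (\<partial>w/\<partial>u)\<^sup>T \<nabla>\<Phi>\<close> onto an intersection of two half-spaces \<open>a\<^sub>i \<bullet> q + c\<^sub>i \<ge> 0\<close>, and under
  the smoothness assumptions \<open>a\<^sub>i\<close>, \<open>c\<^sub>i\<close> and \<open>d\<close> are continuously differentiable, hence locally
  Lipschitz, in \<open>p = (x, u)\<close>: each step of the recursion for \<open>h\<^sub>i\<close> costs one derivative, which
  leaves \<open>h\<^sub>r\<close> twice continuously differentiable (\<open>Ck_h_seq\<close>).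

  Feasibility. Near a point of \<open>C\<close> the vector \<open>q\<close> given at that point keeps working: a constraint
  whose barrier value vanishes there has a positive drift term nearby, and on \<open>C\<close> the barrier term
  does not hurt; a constraint with a positive barrier value is dominated by that value once its
  gain is large. Compactness makes the gains uniform. Both constraints hold strictly, so (SGF)
  satisfies the Slater condition, which also makes it feasible on a neighbourhood in the ambient
  space (\<open>sgf_uniformly_strictly_feasible\<close>, \<open>eventually_sgf_feasible\<close>).

  Lipschitz continuity. If the normals of the constraints are linearly independent, then the
  multipliers are controlled by the difference between the projection and \<open>d\<close>, and subtracting the
  optimality conditions at two parameter values and using complementarity gives a Lipschitz
  estimate (\<open>KKT_perturbation\<close>). The general case reduces to this one. Constraints inactive at \<open>p\<close>
  stay inactive at the minimizer of the problem without them, because that minimizer is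
  continuous (\<open>lipschitz_near_closest_point_active\<close>). Two active constraints with dependent normals
  have parallel normals in a whole neighbourhood by CRCQ, and the Slater point makes them point
  in the same direction; they are then a single half-space constraint with locally Lipschitz
  data (\<open>lipschitz_near_closest_point_constant_rank\<close>).

  Solutions. The right-hand side of the closed loop is Lipschitz on a ball around each point of
  \<open>C\<close>. Picard iteration gives a solution that stays in this ball for a short time, and any other
  solution agrees with it, because the set of times of agreement is open and closed
  (\<open>ode_unique_solution\<close>).
\<close>


section \<open>Projection onto an intersection of half-spaces\<close>

definition halfspaces :: "'i set \<Rightarrow> ('i \<Rightarrow> 'v::euclidean_space) \<Rightarrow> ('i \<Rightarrow> real) \<Rightarrow> 'v set" where
  "halfspaces J a c = {q. \<forall>i\<in>J. 0 \<le> a i \<bullet> q + c i}"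

lemma closed_halfspaces: "closed (halfspaces J a c)"
proof -
  have "halfspaces J a c = (\<Inter>i\<in>J. {q. a i \<bullet> q \<ge> - c i})"
    by (force simp: halfspaces_def)
  then show ?thesis by (auto intro!: closed_INT closed_halfspace_ge)
qed

lemma convex_halfspaces: "convex (halfspaces J a c)"
proof -
  have "halfspaces J a c = (\<Inter>i\<in>J. {q. a i \<bullet> q \<ge> - c i})"
    by (force simp: halfspaces_def)
  then show ?thesis by (auto intro!: convex_INT convex_halfspace_ge)
qed

text \<open>
  Otherwise a hyperplane separates \<open>z\<close> from the cone generated by the vectors, which is closed
  because there are finitely many of them; its normal contradicts \<open>dual\<close>.
\<close>

lemma farkas:
  fixes a :: "'i \<Rightarrow> 'v::euclidean_space"
  assumes "finite A" and dual: "\<And>v. (\<And>i. i \<in> A \<Longrightarrow> 0 \<le> a i \<bullet> v) \<Longrightarrow> 0 \<le> z \<bullet> v"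
  shows "\<exists>\<nu>. (\<forall>i. 0 \<le> \<nu> i) \<and> z = (\<Sum>i\<in>A. \<nu> i *\<^sub>R a i)"
proof -
  let ?K = "convex_cone hull (a ` A)"
  let ?S = "{(\<Sum>i\<in>A. \<nu> i *\<^sub>R a i) | \<nu>. \<forall>i. 0 \<le> \<nu> i}"
  have "z \<in> ?K"
  proof (rule ccontr)
    assume "z \<notin> ?K"
    then obtain v \<beta> where v: "v \<bullet> z < \<beta>" "\<And>x. x \<in> ?K \<Longrightarrow> v \<bullet> x > \<beta>"
      using separating_hyperplane_closed_point[OF convex_convex_cone_hull closed_convex_cone_hull]
        \<open>finite A\<close> by (metis finite_imageI)
    have "\<beta> < 0" using v(2)[OF convex_cone_hull_contains_0] by simp
    have "0 \<le> a i \<bullet> v" if "i \<in> A" for i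
    proof (rule ccontr)
      assume neg: "\<not> 0 \<le> a i \<bullet> v"
      have "(\<beta> / (a i \<bullet> v)) *\<^sub>R a i \<in> ?K"
        using that neg \<open>\<beta> < 0\<close>
        by (intro convex_cone_hull_mul hull_inc) (auto simp: divide_nonpos_neg)
      from v(2)[OF this] neg show False by (simp add: inner_commute)
    qed
    from dual[OF this] v(1) \<open>\<beta> < 0\<close> show False by (simp add: inner_commute)
  qed
  moreover have "?K \<subseteq> ?S"
  proof (rule hull_minimal)
    show "a ` A \<subseteq> ?S"
    proof clarsimp
      fix j assume "j \<in> A"
      then have "a j = (\<Sum>i\<in>A. (if i = j then 1 else 0) *\<^sub>R a i)"
        using \<open>finite A\<close> by (simp add: if_distrib [of "\<lambda>x. x *\<^sub>R _"] sum.delta cong: if_cong)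
      then show "\<exists>\<nu>. a j = (\<Sum>i\<in>A. \<nu> i *\<^sub>R a i) \<and> (\<forall>i. 0 \<le> \<nu> i)"
        by (intro exI[of _ "\<lambda>i. if i = j then 1 else 0"]) auto
    qed
    show "convex_cone ?S"
      unfolding convex_cone_iff
    proof (intro conjI ballI allI impI)
      show "0 \<in> ?S" by (auto intro!: exI[of _ "\<lambda>_. 0"])
    next
      fix x y assume "x \<in> ?S" "y \<in> ?S"
      then obtain \<nu> \<mu> where "\<forall>i. 0 \<le> \<nu> i" "\<forall>i. 0 \<le> \<mu> i"
        "x = (\<Sum>i\<in>A. \<nu> i *\<^sub>R a i)" "y = (\<Sum>i\<in>A. \<mu> i *\<^sub>R a i)" by auto
      then show "x + y \<in> ?S"
        by (auto intro!: exI[of _ "\<lambda>i. \<nu> i + \<mu> i"] simp: sum.distrib scaleR_add_left)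
    next
      fix x and k :: real assume "x \<in> ?S" "0 \<le> k"
      then obtain \<nu> where "\<forall>i. 0 \<le> \<nu> i" "x = (\<Sum>i\<in>A. \<nu> i *\<^sub>R a i)" by auto
      then show "k *\<^sub>R x \<in> ?S" using \<open>0 \<le> k\<close>
        by (auto intro!: exI[of _ "\<lambda>i. k * \<nu> i"] simp: scaleR_sum_right)
    qed
  qed
  ultimately show ?thesis by blast
qed

text \<open>
  Directions that do not violate the constraints active at the projection are feasible for a short
  distance, so the objective cannot decrease along them; Farkas' lemma turns this into
  multipliers.
\<close>

lemma closest_point_halfspaces_KKT:
  fixes a :: "'i \<Rightarrow> 'v::euclidean_space"
  assumes "finite J" and ne: "halfspaces J a c \<noteq> {}"
    and x_def: "x = closest_point (halfspaces J a c) d"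
  shows "\<exists>\<nu>. (\<forall>i\<in>J. 0 \<le> \<nu> i \<and> \<nu> i * (a i \<bullet> x + c i) = 0) \<and> x = d + (\<Sum>i\<in>J. \<nu> i *\<^sub>R a i)"
proof -
  let ?A = "{i\<in>J. a i \<bullet> x + c i = 0}"
  have x: "x \<in> halfspaces J a c"
    unfolding x_def by (rule closest_point_in_set[OF closed_halfspaces ne])
  have "\<exists>\<nu>. (\<forall>i. 0 \<le> \<nu> i) \<and> x - d = (\<Sum>i\<in>?A. \<nu> i *\<^sub>R a i)"
  proof (rule farkas)
    show "finite ?A" using \<open>finite J\<close> by simp
    fix v assume v: "\<And>i. i \<in> ?A \<Longrightarrow> 0 \<le> a i \<bullet> v"
    have "\<forall>\<^sub>F t in at_right 0. \<forall>i\<in>J. 0 \<le> a i \<bullet> (x + t *\<^sub>R v) + c i"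
    proof (rule eventually_ball_finite[OF \<open>finite J\<close>], rule ballI)
      fix i assume i: "i \<in> J"
      show "\<forall>\<^sub>F t in at_right (0::real). 0 \<le> a i \<bullet> (x + t *\<^sub>R v) + c i"
      proof (cases "i \<in> ?A")
        case True
        have "\<forall>\<^sub>F t in at_right (0::real). 0 < t" by (simp add: eventually_at_right_less)
        then show ?thesis
        proof eventually_elim
          case (elim t)
          have "a i \<bullet> (x + t *\<^sub>R v) + c i = (a i \<bullet> x + c i) + t * (a i \<bullet> v)"
            by (simp add: inner_add_right)
          also have "\<dots> \<ge> 0" using True v[OF True] elim by simp
          finally show ?case .
        qed
      next
        case False
        then have pos: "0 < a i \<bullet> x + c i" using x i by (force simp: halfspaces_def)
        have "((\<lambda>t. a i \<bullet> (x + t *\<^sub>R v) + c i) \<longlongrightarrow> a i \<bullet> (x + 0 *\<^sub>R v) + c i) (at_right 0)"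
          by (intro tendsto_intros)
        from order_tendstoD(1)[OF this, of 0] pos show ?thesis
          by (auto elim: eventually_mono)
      qed
    qed
    moreover have "\<forall>\<^sub>F t in at_right (0::real). 0 < t" by (simp add: eventually_at_right_less)
    ultimately have "\<forall>\<^sub>F t in at_right 0. 0 < t \<and> x + t *\<^sub>R v \<in> halfspaces J a c"
      by eventually_elim (simp add: halfspaces_def)
    then obtain t where t: "0 < t" "x + t *\<^sub>R v \<in> halfspaces J a c"
      using eventually_happens'[OF trivial_limit_at_right_real] by blast
    have "(d - x) \<bullet> ((x + t *\<^sub>R v) - x) \<le> 0"
      unfolding x_def by (rule closest_point_dot[OF convex_halfspaces closed_halfspaces t(2)[unfolded x_def]])
    then have "0 \<le> t * ((x - d) \<bullet> v)" by (simp add: inner_diff_left algebra_simps)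
    with t(1) show "0 \<le> (x - d) \<bullet> v" by (simp add: zero_le_mult_iff)
  qed
  then obtain \<nu> where \<nu>: "\<forall>i. 0 \<le> \<nu> i" "x - d = (\<Sum>i\<in>?A. \<nu> i *\<^sub>R a i)" by blast
  let ?l = "\<lambda>i. if i \<in> ?A then \<nu> i else 0"
  have "(\<Sum>i\<in>J. ?l i *\<^sub>R a i) = (\<Sum>i\<in>?A. \<nu> i *\<^sub>R a i)"
    using \<open>finite J\<close> by (intro sum.mono_neutral_cong_right) auto
  moreover have "x = d + (\<Sum>i\<in>?A. \<nu> i *\<^sub>R a i)" using \<nu>(2) by (simp add: diff_eq_eq add.commute)
  ultimately have "(\<forall>i\<in>J. 0 \<le> ?l i \<and> ?l i * (a i \<bullet> x + c i) = 0) \<and> x = d + (\<Sum>i\<in>J. ?l i *\<^sub>R a i)"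
    using \<nu>(1) by simp
  then show ?thesis by (rule exI[of _ ?l])
qed

lemma KKT_imp_closest_point:
  fixes a :: "'i \<Rightarrow> 'v::euclidean_space"
  assumes x: "x \<in> halfspaces J a c"
    and \<nu>: "\<And>i. i \<in> J \<Longrightarrow> 0 \<le> \<nu> i \<and> \<nu> i * (a i \<bullet> x + c i) = 0"
    and eq: "x = d + (\<Sum>i\<in>J. \<nu> i *\<^sub>R a i)"
  shows "closest_point (halfspaces J a c) d = x"
proof (rule closest_point_unique[symmetric, OF convex_halfspaces closed_halfspaces x], rule ballI)
  fix q assume q: "q \<in> halfspaces J a c"
  have "0 \<le> (\<Sum>i\<in>J. \<nu> i * (a i \<bullet> (q - x)))"
  proof (rule sum_nonneg)
    fix i assume i: "i \<in> J"
    have "\<nu> i * (a i \<bullet> (q - x)) = \<nu> i * (a i \<bullet> q + c i) - \<nu> i * (a i \<bullet> x + c i)"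
      by (simp add: inner_diff_right algebra_simps)
    also have "\<dots> = \<nu> i * (a i \<bullet> q + c i)" using \<nu>[OF i] by simp
    also have "\<dots> \<ge> 0" using \<nu>[OF i] q i by (auto simp: halfspaces_def)
    finally show "0 \<le> \<nu> i * (a i \<bullet> (q - x))" .
  qed
  also have "\<dots> = (x - d) \<bullet> (q - x)" by (subst eq) (simp add: inner_sum_left)
  finally have "0 \<le> (x - d) \<bullet> (q - x)" .
  then have "norm (x - d) ^ 2 \<le> norm (q - d) ^ 2"
    using zero_le_power2[of "norm (q - x)"]
    unfolding power2_norm_eq_inner by (simp add: inner_diff_left inner_diff_right inner_commute)
  then show "dist d x \<le> dist d q"
    by (metis dist_norm norm_minus_commute norm_ge_zero power2_le_imp_le)
qed

text \<open>
  Write \<open>W\<^sub>i\<close>, \<open>W'\<^sub>i\<close> for the two constraint values and \<open>y = x - x'\<close>. Complementarity and the signs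
  give \<open>\<Sum> (\<nu>\<^sub>i - \<nu>'\<^sub>i) (W\<^sub>i - W'\<^sub>i) \<le> 0\<close>. Up to errors of size \<open>(1 + R) D\<close> the second factor is
  \<open>a\<^sub>i \<bullet> y\<close> and the sum \<open>\<Sum> (\<nu>\<^sub>i - \<nu>'\<^sub>i) a\<^sub>i\<close> is \<open>y\<close>, so the left-hand side is at least the square of
  \<open>norm y\<close> minus multiples of \<open>D * norm y\<close> and of the square of \<open>D\<close>. Coercivity is what bounds the
  differences of the multipliers, which the errors are multiplied with, in terms of \<open>norm y\<close> and \<open>D\<close>.
\<close>

lemma KKT_perturbation:
  fixes a a' :: "'i \<Rightarrow> 'v::euclidean_space"
  assumes "finite J"
    and \<nu>: "\<And>i. i \<in> J \<Longrightarrow> 0 \<le> \<nu> i \<and> 0 \<le> a i \<bullet> x + c i \<and> \<nu> i * (a i \<bullet> x + c i) = 0"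
    and \<nu>': "\<And>i. i \<in> J \<Longrightarrow> 0 \<le> \<nu>' i \<and> 0 \<le> a' i \<bullet> x' + c' i \<and> \<nu>' i * (a' i \<bullet> x' + c' i) = 0"
    and x: "x = d + (\<Sum>i\<in>J. \<nu> i *\<^sub>R a i)" and x': "x' = d' + (\<Sum>i\<in>J. \<nu>' i *\<^sub>R a' i)"
    and coercive: "\<And>\<mu>. (\<Sum>i\<in>J. \<bar>\<mu> i\<bar>) \<le> \<kappa> * norm (\<Sum>i\<in>J. \<mu> i *\<^sub>R a i)"
    and "0 \<le> \<kappa>"
    and D: "\<And>i. i \<in> J \<Longrightarrow> norm (a i - a' i) \<le> D" "\<And>i. i \<in> J \<Longrightarrow> \<bar>c i - c' i\<bar> \<le> D"
      "norm (d - d') \<le> D"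
    and R: "norm x' \<le> R" "(\<Sum>i\<in>J. \<nu>' i) \<le> R"
  shows "norm (x - x') \<le> (1 + 2 * \<kappa>) * ((1 + R) * D)"
proof -
  have D0: "0 \<le> D" using D(3) norm_ge_zero order_trans by blast
  have R0: "0 \<le> R" using R(1) norm_ge_zero order_trans by blast
  define K where "K = (1 + R) * D"
  have K0: "0 \<le> K" using D0 R0 by (simp add: K_def)
  define y where "y = x - x'"
  define \<delta> where "\<delta> = (d - d') + (\<Sum>i\<in>J. \<nu>' i *\<^sub>R (a i - a' i))"
  define e where "e i = (a i - a' i) \<bullet> x' + (c i - c' i)" for i
  have \<delta>: "norm \<delta> \<le> K"
  proof -
    have "norm (\<Sum>i\<in>J. \<nu>' i *\<^sub>R (a i - a' i)) \<le> (\<Sum>i\<in>J. \<nu>' i * D)"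
      using \<nu>' D(1) by (intro sum_norm_le) (simp add: mult_left_mono)
    also have "\<dots> = (\<Sum>i\<in>J. \<nu>' i) * D" by (simp add: sum_distrib_right)
    also have "\<dots> \<le> R * D" using R(2) D0 by (rule mult_right_mono)
    finally show ?thesis using D(3) unfolding \<delta>_def K_def
      by (intro norm_triangle_le) (simp add: algebra_simps)
  qed
  have e: "\<bar>e i\<bar> \<le> K" if "i \<in> J" for i
  proof -
    have "\<bar>(a i - a' i) \<bullet> x'\<bar> \<le> norm (a i - a' i) * norm x'" by (rule Cauchy_Schwarz_ineq2)
    also have "\<dots> \<le> D * R" using D(1)[OF that] R(1) D0 by (intro mult_mono) auto
    finally show ?thesis using D(2)[OF that] unfolding e_def K_def by (simp add: algebra_simps)
  qed
  have comb: "(\<Sum>i\<in>J. (\<nu> i - \<nu>' i) *\<^sub>R a i) = y - \<delta>"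
    unfolding y_def \<delta>_def x x'
    by (simp add: scaleR_diff_left scaleR_diff_right sum_subtractf)
  have S: "(\<Sum>i\<in>J. \<bar>\<nu> i - \<nu>' i\<bar>) \<le> \<kappa> * (norm y + K)"
  proof -
    have "(\<Sum>i\<in>J. \<bar>\<nu> i - \<nu>' i\<bar>) \<le> \<kappa> * norm (y - \<delta>)"
      using coercive[of "\<lambda>i. \<nu> i - \<nu>' i"] by (simp add: comb)
    also have "\<dots> \<le> \<kappa> * (norm y + K)"
      using \<open>0 \<le> \<kappa>\<close> \<delta> norm_triangle_ineq4[of y \<delta>] by (intro mult_left_mono) auto
    finally show ?thesis .
  qed
  have "(\<Sum>i\<in>J. (\<nu> i - \<nu>' i) * (a i \<bullet> y + e i)) \<le> 0"
  proof (rule sum_nonpos)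
    fix i assume i: "i \<in> J"
    define W W' where "W = a i \<bullet> x + c i" and "W' = a' i \<bullet> x' + c' i"
    have "a i \<bullet> y + e i = W - W'"
      by (simp add: y_def e_def W_def W'_def inner_diff_left inner_diff_right)
    then have "(\<nu> i - \<nu>' i) * (a i \<bullet> y + e i) = \<nu> i * W + \<nu>' i * W' - \<nu> i * W' - \<nu>' i * W"
      by (simp add: left_diff_distrib right_diff_distrib)
    also have "\<dots> \<le> 0"
    proof -
      have "\<nu> i * W = 0" "\<nu>' i * W' = 0" "0 \<le> \<nu> i * W'" "0 \<le> \<nu>' i * W"
        using \<nu>[OF i] \<nu>'[OF i] unfolding W_def W'_def by simp_all
      then show ?thesis by linarith
    qed
    finally show "(\<nu> i - \<nu>' i) * (a i \<bullet> y + e i) \<le> 0" .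
  qed
  moreover have "(\<Sum>i\<in>J. (\<nu> i - \<nu>' i) * (a i \<bullet> y + e i)) =
      (y - \<delta>) \<bullet> y + (\<Sum>i\<in>J. (\<nu> i - \<nu>' i) * e i)"
    by (simp add: comb[symmetric] inner_sum_left distrib_left sum.distrib)
  moreover have "\<bar>\<Sum>i\<in>J. (\<nu> i - \<nu>' i) * e i\<bar> \<le> \<kappa> * (norm y + K) * K"
  proof -
    have "\<bar>\<Sum>i\<in>J. (\<nu> i - \<nu>' i) * e i\<bar> \<le> (\<Sum>i\<in>J. \<bar>\<nu> i - \<nu>' i\<bar> * K)"
      using e by (intro sum_norm_le[where 'a=real, unfolded real_norm_def]) (simp add: abs_mult mult_left_mono)
    also have "\<dots> = (\<Sum>i\<in>J. \<bar>\<nu> i - \<nu>' i\<bar>) * K" by (simp add: sum_distrib_right)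
    also have "\<dots> \<le> \<kappa> * (norm y + K) * K" using S K0 by (rule mult_right_mono)
    finally show ?thesis .
  qed
  moreover have "\<delta> \<bullet> y \<le> K * norm y"
    using norm_cauchy_schwarz[of \<delta> y] \<delta> by (meson mult_right_mono norm_ge_zero order_trans)
  ultimately have main: "norm y * norm y \<le> K * norm y + \<kappa> * (norm y + K) * K"
    by (simp add: inner_diff_left power2_norm_eq_inner[symmetric] power2_eq_square)
  show ?thesis
  proof (cases "norm y \<le> K")
    case True
    moreover have "K \<le> (1 + 2 * \<kappa>) * K" using K0 \<open>0 \<le> \<kappa>\<close> by (simp add: distrib_right)
    ultimately show ?thesis unfolding y_def K_def by linarith
  next
    case False
    then have "\<kappa> * (norm y + K) * K \<le> \<kappa> * (norm y + norm y) * K"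
      using K0 \<open>0 \<le> \<kappa>\<close> by (intro mult_right_mono mult_left_mono) auto
    with main have "norm y * norm y \<le> ((1 + 2 * \<kappa>) * K) * norm y"
      by (simp add: algebra_simps)
    then have "norm y \<le> (1 + 2 * \<kappa>) * K"
      using False K0 by (subst (asm) mult_le_cancel_right) auto
    then show ?thesis unfolding y_def K_def .
  qed
qed

text \<open>
  The component \<open>v\<close> of \<open>a\<^sub>i\<close> orthogonal to the span of the other vectors is nonzero, and the inner
  product with \<open>v\<close> reads off the coefficient \<open>\<mu>\<^sub>i\<close>.
\<close>

lemma independent_coercive:
  fixes a :: "'i \<Rightarrow> 'v::euclidean_space"
  assumes "finite J" and indep: "\<And>i. i \<in> J \<Longrightarrow> a i \<notin> span (a ` (J - {i}))"
  shows "\<exists>\<kappa>>0. \<forall>\<mu>. (\<Sum>i\<in>J. \<bar>\<mu> i\<bar>) \<le> \<kappa> * norm (\<Sum>i\<in>J. \<mu> i *\<^sub>R a i)"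
proof -
  have "\<exists>B. \<forall>\<mu>. \<bar>\<mu> i\<bar> \<le> B * norm (\<Sum>j\<in>J. \<mu> j *\<^sub>R a j)" if i: "i \<in> J" for i
  proof -
    obtain y v where y: "y \<in> span (a ` (J - {i}))" and v: "\<And>w. w \<in> span (a ` (J - {i})) \<Longrightarrow> orthogonal v w"
      and eq: "a i = y + v"
      using orthogonal_subspace_decomp_exists[of "a ` (J - {i})" "a i"] by metis
    have "v \<noteq> 0" using indep[OF i] y eq by auto
    have "\<bar>\<mu> i\<bar> \<le> (1 / norm v) * norm (\<Sum>j\<in>J. \<mu> j *\<^sub>R a j)" for \<mu>
    proof -
      have "(\<Sum>j\<in>J - {i}. \<mu> j * (a j \<bullet> v)) = 0"
      proof (intro sum.neutral ballI)
        fix j assume "j \<in> J - {i}"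
        then have "a j \<in> span (a ` (J - {i}))" by (intro span_base) auto
        from v[OF this] show "\<mu> j * (a j \<bullet> v) = 0" by (simp add: orthogonal_def inner_commute)
      qed
      moreover have "a i \<bullet> v = norm v * norm v"
        using v[OF y] unfolding eq orthogonal_def
        by (simp only: inner_add_left inner_commute[of y] power2_norm_eq_inner[symmetric] power2_eq_square)
      ultimately have "(\<Sum>j\<in>J. \<mu> j *\<^sub>R a j) \<bullet> v = \<mu> i * (norm v * norm v)"
        using i \<open>finite J\<close> by (simp add: inner_sum_left inner_add_left sum.remove[of J i])
      then have "\<bar>\<mu> i\<bar> * (norm v * norm v) \<le> norm (\<Sum>j\<in>J. \<mu> j *\<^sub>R a j) * norm v"
        using Cauchy_Schwarz_ineq2[of "\<Sum>j\<in>J. \<mu> j *\<^sub>R a j" v] by (simp add: abs_mult)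
      then show ?thesis using \<open>v \<noteq> 0\<close> by (simp add: field_simps)
    qed
    then show ?thesis by blast
  qed
  then obtain B where B: "\<And>i \<mu>. i \<in> J \<Longrightarrow> \<bar>\<mu> i\<bar> \<le> B i * norm (\<Sum>j\<in>J. \<mu> j *\<^sub>R a j)"
    by metis
  define \<kappa> where "\<kappa> = 1 + \<bar>\<Sum>i\<in>J. B i\<bar>"
  have "(\<Sum>i\<in>J. \<bar>\<mu> i\<bar>) \<le> \<kappa> * norm (\<Sum>i\<in>J. \<mu> i *\<^sub>R a i)" for \<mu>
  proof -
    have "(\<Sum>i\<in>J. \<bar>\<mu> i\<bar>) \<le> (\<Sum>i\<in>J. B i) * norm (\<Sum>j\<in>J. \<mu> j *\<^sub>R a j)"
      using B by (simp add: sum_distrib_right sum_mono)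
    also have "\<dots> \<le> \<kappa> * norm (\<Sum>j\<in>J. \<mu> j *\<^sub>R a j)"
      by (rule mult_right_mono) (auto simp: \<kappa>_def)
    finally show ?thesis .
  qed
  moreover have "\<kappa> > 0" by (simp add: \<kappa>_def)
  ultimately show ?thesis by (intro exI[of _ \<kappa>] conjI allI)
qed

lemma coercive_perturbation:
  fixes a a' :: "'i \<Rightarrow> 'v::euclidean_space"
  assumes coercive: "\<And>\<mu>. (\<Sum>i\<in>J. \<bar>\<mu> i\<bar>) \<le> \<kappa> * norm (\<Sum>i\<in>J. \<mu> i *\<^sub>R a i)"
    and "\<kappa> > 0" and close: "\<And>i. i \<in> J \<Longrightarrow> norm (a i - a' i) \<le> 1 / (2 * \<kappa>)"
  shows "(\<Sum>i\<in>J. \<bar>\<mu> i\<bar>) \<le> 2 * \<kappa> * norm (\<Sum>i\<in>J. \<mu> i *\<^sub>R a' i)"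
proof -
  have "norm (\<Sum>i\<in>J. \<mu> i *\<^sub>R (a i - a' i)) \<le> (\<Sum>i\<in>J. \<bar>\<mu> i\<bar> * (1 / (2 * \<kappa>)))"
    using close by (intro sum_norm_le) (simp only: norm_scaleR mult_left_mono abs_ge_zero)
  also have "\<dots> = (\<Sum>i\<in>J. \<bar>\<mu> i\<bar>) * (1 / (2 * \<kappa>))" by (simp only: sum_distrib_right)
  also have "\<dots> = (\<Sum>i\<in>J. \<bar>\<mu> i\<bar>) / (2 * \<kappa>)" by simp
  finally have diff: "norm (\<Sum>i\<in>J. \<mu> i *\<^sub>R (a i - a' i)) \<le> (\<Sum>i\<in>J. \<bar>\<mu> i\<bar>) / (2 * \<kappa>)" .
  have "(\<Sum>i\<in>J. \<mu> i *\<^sub>R a i) = (\<Sum>i\<in>J. \<mu> i *\<^sub>R a' i) + (\<Sum>i\<in>J. \<mu> i *\<^sub>R (a i - a' i))"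
    by (simp add: scaleR_diff_right sum_subtractf)
  then have "norm (\<Sum>i\<in>J. \<mu> i *\<^sub>R a i) \<le> norm (\<Sum>i\<in>J. \<mu> i *\<^sub>R a' i) + (\<Sum>i\<in>J. \<bar>\<mu> i\<bar>) / (2 * \<kappa>)"
    using diff by (simp only: norm_triangle_le add_left_mono)
  then have "\<kappa> * norm (\<Sum>i\<in>J. \<mu> i *\<^sub>R a i)
      \<le> \<kappa> * (norm (\<Sum>i\<in>J. \<mu> i *\<^sub>R a' i) + (\<Sum>i\<in>J. \<bar>\<mu> i\<bar>) / (2 * \<kappa>))"
    using \<open>\<kappa> > 0\<close> by simp
  also have "\<dots> = \<kappa> * norm (\<Sum>i\<in>J. \<mu> i *\<^sub>R a' i) + (\<Sum>i\<in>J. \<bar>\<mu> i\<bar>) / 2"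
    using \<open>\<kappa> > 0\<close> by (simp add: field_simps)
  finally show ?thesis using coercive[of \<mu>] by simp
qed


section \<open>Lipschitz continuity near a point\<close>

text \<open>
  The neighbourhood is expressed by a filter on pairs of points, so that finitely many such
  conditions combine by filter reasoning without bookkeeping of radii. It is the usual Lipschitz
  condition on some ball, see \<open>lipschitz_near_iff_ball\<close>.
\<close>

definition lipschitz_near :: "('a::metric_space \<Rightarrow> 'b::metric_space) \<Rightarrow> 'a \<Rightarrow> bool" where
  "lipschitz_near g p \<longleftrightarrow>
     (\<exists>L. \<forall>\<^sub>F z in nhds (p, p). dist (g (fst z)) (g (snd z)) \<le> L * dist (fst z) (snd z))"

lemma lipschitz_nearI:
  assumes "\<forall>\<^sub>F z in nhds (p, p). dist (g (fst z)) (g (snd z)) \<le> L * dist (fst z) (snd z)"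
  shows "lipschitz_near g p"
  unfolding lipschitz_near_def by (intro exI[of _ L] assms)

lemma eventually_nhds_pair:
  assumes "\<forall>\<^sub>F x in nhds p. P x"
  shows "\<forall>\<^sub>F z in nhds (p, p). P (fst z) \<and> P (snd z)"
  using assms unfolding nhds_prod eventually_prod_filter by auto

lemma eventually_nhds_pair_ball:
  fixes p :: "'a::metric_space"
  assumes "\<forall>\<^sub>F z in nhds (p, p). P z"
  shows "\<exists>\<delta>>0. \<forall>x\<in>ball p \<delta>. \<forall>y\<in>ball p \<delta>. P (x, y)"
proof -
  from assms obtain Q Q' where Q: "eventually Q (nhds p)" "eventually Q' (nhds p)"
    and PQ: "\<And>x y. Q x \<Longrightarrow> Q' y \<Longrightarrow> P (x, y)"
    unfolding nhds_prod eventually_prod_filter by auto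
  from eventually_conj[OF Q] obtain \<delta> where "\<delta> > 0" "\<forall>x. dist x p < \<delta> \<longrightarrow> Q x \<and> Q' x"
    unfolding eventually_nhds_metric by blast
  then show ?thesis using PQ by (intro exI[of _ \<delta>]) (auto simp: dist_commute)
qed

lemma lipschitz_near_iff_ball:
  "lipschitz_near g p \<longleftrightarrow> (\<exists>\<delta>>0. \<exists>L. L-lipschitz_on (ball p \<delta>) g)"
proof
  assume "lipschitz_near g p"
  then obtain L where
    "\<forall>\<^sub>F z in nhds (p, p). dist (g (fst z)) (g (snd z)) \<le> L * dist (fst z) (snd z)"
    unfolding lipschitz_near_def by blast
  from eventually_nhds_pair_ball[OF this] obtain \<delta> where \<delta>: "\<delta> > 0"
    "\<And>x y. x \<in> ball p \<delta> \<Longrightarrow> y \<in> ball p \<delta> \<Longrightarrow> dist (g x) (g y) \<le> L * dist x y" by auto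
  have "\<bar>L\<bar>-lipschitz_on (ball p \<delta>) g"
  proof (rule lipschitz_onI)
    fix x y assume "x \<in> ball p \<delta>" "y \<in> ball p \<delta>"
    then have "dist (g x) (g y) \<le> L * dist x y" by (rule \<delta>(2))
    also have "\<dots> \<le> \<bar>L\<bar> * dist x y" by (intro mult_right_mono) auto
    finally show "dist (g x) (g y) \<le> \<bar>L\<bar> * dist x y" .
  qed simp
  with \<delta>(1) show "\<exists>\<delta>>0. \<exists>L. L-lipschitz_on (ball p \<delta>) g" by blast
next
  assume "\<exists>\<delta>>0. \<exists>L. L-lipschitz_on (ball p \<delta>) g"
  then obtain \<delta> L where \<delta>: "\<delta> > 0" and L: "L-lipschitz_on (ball p \<delta>) g" by blast
  have "\<forall>\<^sub>F x in nhds p. x \<in> ball p \<delta>"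
    using \<delta> by (intro eventually_nhds_in_open) auto
  from eventually_nhds_pair[OF this]
  have "\<forall>\<^sub>F z in nhds (p, p). dist (g (fst z)) (g (snd z)) \<le> L * dist (fst z) (snd z)"
    by eventually_elim (blast intro: lipschitz_onD[OF L])
  then show "lipschitz_near g p" by (intro lipschitz_nearI)
qed

lemma lipschitz_near_imp_tendsto:
  assumes "lipschitz_near g p"
  shows "(g \<longlongrightarrow> g p) (nhds p)"
proof -
  obtain \<delta> L where \<delta>: "\<delta> > 0" and L: "L-lipschitz_on (ball p \<delta>) g"
    using assms unfolding lipschitz_near_iff_ball by blast
  have "isCont g p"
    using lipschitz_on_continuous_on[OF L] \<delta> by (simp add: continuous_on_eq_continuous_at)
  then show ?thesis by (simp add: isCont_def tendsto_at_iff_tendsto_nhds)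
qed

lemma lipschitz_near_transform:
  assumes "lipschitz_near g p" "\<forall>\<^sub>F x in nhds p. g x = k x"
  shows "lipschitz_near k p"
proof -
  obtain L where "\<forall>\<^sub>F z in nhds (p, p). dist (g (fst z)) (g (snd z)) \<le> L * dist (fst z) (snd z)"
    using assms(1) unfolding lipschitz_near_def by blast
  with eventually_nhds_pair[OF assms(2)]
  have "\<forall>\<^sub>F z in nhds (p, p). dist (k (fst z)) (k (snd z)) \<le> L * dist (fst z) (snd z)"
    by eventually_elim simp
  then show ?thesis by (intro lipschitz_nearI)
qed

lemma lipschitz_near_bilinear:
  fixes g :: "'a::metric_space \<Rightarrow> 'b::real_normed_vector" and k :: "'a \<Rightarrow> 'c::real_normed_vector"
    and pr :: "'b \<Rightarrow> 'c \<Rightarrow> 'd::real_normed_vector"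
  assumes pr: "bounded_bilinear pr" and g: "lipschitz_near g p" and k: "lipschitz_near k p"
  shows "lipschitz_near (\<lambda>x. pr (g x) (k x)) p"
proof -
  interpret bounded_bilinear pr by fact
  obtain B where B: "0 \<le> B" "\<And>u v. norm (pr u v) \<le> norm u * norm v * B"
    using nonneg_bounded by blast
  obtain L where
    L: "\<forall>\<^sub>F z in nhds (p, p). dist (g (fst z)) (g (snd z)) \<le> L * dist (fst z) (snd z)"
    using g unfolding lipschitz_near_def by blast
  obtain M where
    M: "\<forall>\<^sub>F z in nhds (p, p). dist (k (fst z)) (k (snd z)) \<le> M * dist (fst z) (snd z)"
    using k unfolding lipschitz_near_def by blast
  have "\<forall>\<^sub>F x in nhds p. norm (g x) < norm (g p) + 1 \<and> norm (k x) < norm (k p) + 1"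
    by (intro eventually_conj order_tendstoD(2)[OF tendsto_norm[OF lipschitz_near_imp_tendsto[OF g]]]
        order_tendstoD(2)[OF tendsto_norm[OF lipschitz_near_imp_tendsto[OF k]]]) simp_all
  from L M eventually_nhds_pair[OF this]
  have "\<forall>\<^sub>F z in nhds (p, p). dist (pr (g (fst z)) (k (fst z))) (pr (g (snd z)) (k (snd z)))
      \<le> ((L * (norm (k p) + 1) + (norm (g p) + 1) * M) * B) * dist (fst z) (snd z)"
  proof eventually_elim
    case (elim z)
    define x y where "x = fst z" and "y = snd z"
    have gz: "norm (g x - g y) \<le> L * dist x y" and kz: "norm (k x - k y) \<le> M * dist x y"
      and bd: "norm (k x) \<le> norm (k p) + 1" "norm (g y) \<le> norm (g p) + 1"
      using elim unfolding x_def y_def dist_norm[symmetric] by auto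
    have nn: "0 \<le> L * dist x y" "0 \<le> M * dist x y"
      using order_trans[OF norm_ge_zero gz] order_trans[OF norm_ge_zero kz] by blast+
    have "norm (pr (g x - g y) (k x)) \<le> norm (g x - g y) * norm (k x) * B" by (rule B)
    also have "\<dots> \<le> (L * dist x y) * (norm (k p) + 1) * B"
      by (intro mult_right_mono mult_mono gz kz bd B(1) nn add_nonneg_nonneg norm_ge_zero zero_le_one)
    finally have 1: "norm (pr (g x - g y) (k x)) \<le> (L * dist x y) * (norm (k p) + 1) * B" .
    have "norm (pr (g y) (k x - k y)) \<le> norm (g y) * norm (k x - k y) * B" by (rule B)
    also have "\<dots> \<le> (norm (g p) + 1) * (M * dist x y) * B"
      by (intro mult_right_mono mult_mono gz kz bd B(1) nn add_nonneg_nonneg norm_ge_zero zero_le_one)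
    finally have 2: "norm (pr (g y) (k x - k y)) \<le> (norm (g p) + 1) * (M * dist x y) * B" .
    have "pr (g x) (k x) - pr (g y) (k y) = pr (g x - g y) (k x) + pr (g y) (k x - k y)"
      by (simp add: diff_left diff_right)
    then have "dist (pr (g x) (k x)) (pr (g y) (k y))
        \<le> norm (pr (g x - g y) (k x)) + norm (pr (g y) (k x - k y))"
      by (simp add: dist_norm norm_triangle_ineq)
    with 1 2 show ?case unfolding x_def y_def by (simp add: algebra_simps)
  qed
  then show ?thesis by (intro lipschitz_nearI)
qed

lemma lipschitz_near_min:
  fixes g k :: "'a::metric_space \<Rightarrow> real"
  assumes "lipschitz_near g p" "lipschitz_near k p"
  shows "lipschitz_near (\<lambda>x. min (g x) (k x)) p"
proof -
  obtain L where
    L: "\<forall>\<^sub>F z in nhds (p, p). dist (g (fst z)) (g (snd z)) \<le> L * dist (fst z) (snd z)"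
    using assms unfolding lipschitz_near_def by blast
  obtain M where
    M: "\<forall>\<^sub>F z in nhds (p, p). dist (k (fst z)) (k (snd z)) \<le> M * dist (fst z) (snd z)"
    using assms unfolding lipschitz_near_def by blast
  have "\<forall>\<^sub>F z in nhds (p, p). dist (min (g (fst z)) (k (fst z))) (min (g (snd z)) (k (snd z)))
      \<le> (L + M) * dist (fst z) (snd z)"
    using L M by eventually_elim (auto simp: dist_real_def min_def distrib_right)
  then show ?thesis by (intro lipschitz_nearI)
qed

lemma lipschitz_near_finite:
  assumes "finite J" "\<And>i. i \<in> J \<Longrightarrow> lipschitz_near (g i) p"
  shows "\<exists>L\<ge>0. \<forall>\<^sub>F z in nhds (p, p). \<forall>i\<in>J. dist (g i (fst z)) (g i (snd z)) \<le> L * dist (fst z) (snd z)"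
proof -
  have "\<forall>i\<in>J. \<exists>L. \<forall>\<^sub>F z in nhds (p, p). dist (g i (fst z)) (g i (snd z)) \<le> L * dist (fst z) (snd z)"
    using assms(2) unfolding lipschitz_near_def by blast
  then obtain L where L: "\<And>i. i \<in> J \<Longrightarrow>
      \<forall>\<^sub>F z in nhds (p, p). dist (g i (fst z)) (g i (snd z)) \<le> L i * dist (fst z) (snd z)"
    by (auto simp: bchoice_iff)
  have "\<forall>\<^sub>F z in nhds (p, p). dist (g i (fst z)) (g i (snd z)) \<le> (\<Sum>i\<in>J. \<bar>L i\<bar>) * dist (fst z) (snd z)"
    if i: "i \<in> J" for i
    using L[OF i]
  proof eventually_elim
    case (elim z)
    have "L i \<le> (\<Sum>i\<in>J. \<bar>L i\<bar>)"
      using member_le_sum[OF i, of "\<lambda>i. \<bar>L i\<bar>"] \<open>finite J\<close> by simp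
    then show ?case using elim by (meson mult_right_mono order_trans zero_le_dist)
  qed
  then show ?thesis using \<open>finite J\<close>
    by (intro exI[of _ "\<Sum>i\<in>J. \<bar>L i\<bar>"] conjI eventually_ball_finite) (auto simp: sum_nonneg)
qed


section \<open>Lipschitz dependence of the projection on parameters\<close>

text \<open>
  The data needed by \<open>KKT_perturbation\<close> hold uniformly near \<open>p\<close>: coercivity survives small
  perturbations of the normals, the feasible point \<open>q\<close> bounds the distance from \<open>d\<close> to its
  projection, and coercivity then bounds the multipliers.
\<close>

lemma lipschitz_near_closest_point_independent:
  fixes a :: "'i \<Rightarrow> 'p::metric_space \<Rightarrow> 'v::euclidean_space"
  assumes "finite J"
    and a: "\<And>i. i \<in> J \<Longrightarrow> lipschitz_near (a i) p"
    and c: "\<And>i. i \<in> J \<Longrightarrow> lipschitz_near (c i) p"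
    and d: "lipschitz_near d p"
    and indep: "\<And>i. i \<in> J \<Longrightarrow> a i p \<notin> span ((\<lambda>j. a j p) ` (J - {i}))"
    and feas: "\<forall>\<^sub>F x in nhds p. q \<in> halfspaces J (\<lambda>i. a i x) (\<lambda>i. c i x)"
  shows "lipschitz_near (\<lambda>x. closest_point (halfspaces J (\<lambda>i. a i x) (\<lambda>i. c i x)) (d x)) p"
proof -
  define K where "K x = halfspaces J (\<lambda>i. a i x) (\<lambda>i. c i x)" for x
  define g where "g x = closest_point (K x) (d x)" for x
  obtain \<kappa> where "\<kappa> > 0" and \<kappa>: "\<And>\<mu>. (\<Sum>i\<in>J. \<bar>\<mu> i\<bar>) \<le> \<kappa> * norm (\<Sum>i\<in>J. \<mu> i *\<^sub>R a i p)"
    using independent_coercive[of J "\<lambda>i. a i p"] \<open>finite J\<close> indep by blast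
  have "\<exists>L\<ge>0. \<forall>\<^sub>F z in nhds (p, p). \<forall>i\<in>J. dist (a i (fst z)) (a i (snd z)) \<le> L * dist (fst z) (snd z)"
    using \<open>finite J\<close> a by (rule lipschitz_near_finite)
  then obtain La where La: "0 \<le> La" "\<forall>\<^sub>F z in nhds (p, p). \<forall>i\<in>J. dist (a i (fst z)) (a i (snd z)) \<le> La * dist (fst z) (snd z)"
    by (elim exE conjE) (rule that)
  have "\<exists>L\<ge>0. \<forall>\<^sub>F z in nhds (p, p). \<forall>i\<in>J. dist (c i (fst z)) (c i (snd z)) \<le> L * dist (fst z) (snd z)"
    using \<open>finite J\<close> c by (rule lipschitz_near_finite)
  then obtain Lc where Lc: "0 \<le> Lc" "\<forall>\<^sub>F z in nhds (p, p). \<forall>i\<in>J. dist (c i (fst z)) (c i (snd z)) \<le> Lc * dist (fst z) (snd z)"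
    by (elim exE conjE) (rule that)
  have "\<exists>L\<ge>0. \<forall>\<^sub>F z in nhds (p, p). \<forall>i\<in>{()}. dist (d (fst z)) (d (snd z)) \<le> L * dist (fst z) (snd z)"
    by (rule lipschitz_near_finite) (simp_all add: d)
  then obtain Ld where Ld: "0 \<le> Ld" "\<forall>\<^sub>F z in nhds (p, p). dist (d (fst z)) (d (snd z)) \<le> Ld * dist (fst z) (snd z)"
    by auto
  define L where "L = La + Lc + Ld"
  define M where "M = norm q + (norm (d p) + 1)"
  define R where "R = M + norm (d p) + 1 + 2 * \<kappa> * M"
  define coer where "coer x \<longleftrightarrow> (\<forall>\<mu>. (\<Sum>i\<in>J. \<bar>\<mu> i\<bar>) \<le> 2 * \<kappa> * norm (\<Sum>i\<in>J. \<mu> i *\<^sub>R a i x))" for x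
  define KKT where "KKT x \<nu> \<longleftrightarrow>
      (\<forall>i\<in>J. 0 \<le> \<nu> i \<and> 0 \<le> a i x \<bullet> g x + c i x \<and> \<nu> i * (a i x \<bullet> g x + c i x) = 0) \<and>
      g x = d x + (\<Sum>i\<in>J. \<nu> i *\<^sub>R a i x) \<and> norm (g x) \<le> R \<and> (\<Sum>i\<in>J. \<nu> i) \<le> R" for x \<nu>
  have "\<forall>\<^sub>F x in nhds p. \<forall>i\<in>J. norm (a i p - a i x) \<le> 1 / (2 * \<kappa>)"
  proof (rule eventually_ball_finite[OF \<open>finite J\<close>], rule ballI)
    fix i assume "i \<in> J"
    have "1 / (2 * \<kappa>) > 0" using \<open>\<kappa> > 0\<close> by simp
    from tendstoD[OF lipschitz_near_imp_tendsto[OF a[OF \<open>i \<in> J\<close>]] this]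
    show "\<forall>\<^sub>F x in nhds p. norm (a i p - a i x) \<le> 1 / (2 * \<kappa>)"
      by (auto elim!: eventually_mono simp: dist_norm norm_minus_commute)
  qed
  moreover have "\<forall>\<^sub>F x in nhds p. norm (d x) < norm (d p) + 1"
    by (rule order_tendstoD(2)[OF tendsto_norm[OF lipschitz_near_imp_tendsto[OF d]]]) simp
  ultimately have "\<forall>\<^sub>F x in nhds p. coer x \<and> (\<exists>\<nu>. KKT x \<nu>)"
    using feas
  proof eventually_elim
    case (elim x)
    have coercive: "(\<Sum>i\<in>J. \<bar>\<mu> i\<bar>) \<le> 2 * \<kappa> * norm (\<Sum>i\<in>J. \<mu> i *\<^sub>R a i x)" for \<mu>
      using \<kappa> \<open>\<kappa> > 0\<close> elim(1) by (intro coercive_perturbation[where a = "\<lambda>i. a i p"]) auto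
    have q: "q \<in> K x" using elim(3) by (simp add: K_def)
    then have ne: "halfspaces J (\<lambda>i. a i x) (\<lambda>i. c i x) \<noteq> {}" by (auto simp: K_def)
    have gK: "g x \<in> K x" unfolding g_def K_def by (rule closest_point_in_set[OF closed_halfspaces ne])
    obtain \<nu> where \<nu>: "\<forall>i\<in>J. 0 \<le> \<nu> i \<and> \<nu> i * (a i x \<bullet> g x + c i x) = 0"
      and eq: "g x = d x + (\<Sum>i\<in>J. \<nu> i *\<^sub>R a i x)"
      using closest_point_halfspaces_KKT[OF \<open>finite J\<close> ne g_def[of x, unfolded K_def]] by (elim exE conjE) (rule that)
    have "dist (d x) (g x) \<le> dist (d x) q"
      using q unfolding g_def K_def by (intro closest_point_le[OF closed_halfspaces])
    also have "\<dots> \<le> M" using elim(2) norm_triangle_ineq4[of "d x" q] by (simp add: M_def dist_norm)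
    finally have gd: "norm (g x - d x) \<le> M" by (simp add: dist_norm norm_minus_commute)
    have M0: "0 \<le> M" by (simp add: M_def)
    have "norm (g x) \<le> norm (g x - d x) + norm (d x)" by (metis diff_add_cancel norm_triangle_ineq)
    moreover have "0 \<le> 2 * \<kappa> * M" using M0 \<open>\<kappa> > 0\<close> by simp
    ultimately have "norm (g x) \<le> R" using gd elim(2) unfolding R_def by linarith
    moreover have "(\<Sum>i\<in>J. \<nu> i) \<le> R"
    proof -
      have "(\<Sum>i\<in>J. \<nu> i) = (\<Sum>i\<in>J. \<bar>\<nu> i\<bar>)" using \<nu> by (intro sum.cong) auto
      also have "\<dots> \<le> 2 * \<kappa> * norm (g x - d x)" using coercive[of \<nu>] by (simp add: eq)
      also have "\<dots> \<le> 2 * \<kappa> * M" using gd \<open>\<kappa> > 0\<close> by simp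
      also have "\<dots> \<le> R" using M0 by (simp add: R_def add_nonneg_nonneg)
      finally show ?thesis .
    qed
    moreover have "\<forall>i\<in>J. 0 \<le> \<nu> i \<and> 0 \<le> a i x \<bullet> g x + c i x \<and> \<nu> i * (a i x \<bullet> g x + c i x) = 0"
      using gK \<nu> by (simp add: K_def halfspaces_def)
    ultimately have "KKT x \<nu>" unfolding KKT_def using eq by (intro conjI)
    moreover have "coer x" unfolding coer_def using coercive by (rule allI)
    ultimately show ?case by blast
  qed
  from eventually_nhds_pair[OF this] La(2) Lc(2) Ld(2)
  have "\<forall>\<^sub>F z in nhds (p, p). dist (g (fst z)) (g (snd z)) \<le>
      ((1 + 2 * (2 * \<kappa>)) * ((1 + R) * L)) * dist (fst z) (snd z)"
  proof eventually_elim
    case (elim z)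
    define x y where "x = fst z" and "y = snd z"
    obtain \<nu> \<nu>' where "KKT x \<nu>" "KKT y \<nu>'" and "coer x" using elim(1) unfolding x_def y_def by blast
    note \<nu> = \<open>KKT x \<nu>\<close>[unfolded KKT_def, THEN conjunct1]
      \<open>KKT x \<nu>\<close>[unfolded KKT_def, THEN conjunct2, THEN conjunct1]
    note KKT' = \<open>KKT y \<nu>'\<close>[unfolded KKT_def]
    note \<nu>' = KKT'[THEN conjunct1] KKT'[THEN conjunct2, THEN conjunct1]
      KKT'[THEN conjunct2, THEN conjunct2, THEN conjunct1]
      KKT'[THEN conjunct2, THEN conjunct2, THEN conjunct2]
    have \<kappa>2: "(\<Sum>i\<in>J. \<bar>\<mu> i\<bar>) \<le> 2 * \<kappa> * norm (\<Sum>i\<in>J. \<mu> i *\<^sub>R a i x)" for \<mu>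
      using \<open>coer x\<close> unfolding coer_def by (rule spec)
    have le: "La * dist x y \<le> L * dist x y" "Lc * dist x y \<le> L * dist x y" "Ld * dist x y \<le> L * dist x y"
      using La(1) Lc(1) Ld(1) by (auto intro!: mult_right_mono simp: L_def)
    have "norm (g x - g y) \<le> (1 + 2 * (2 * \<kappa>)) * ((1 + R) * (L * dist x y))"
    proof (rule KKT_perturbation[OF \<open>finite J\<close> _ _ \<nu>(2) \<nu>'(2) \<kappa>2 _ _ _ _ \<nu>'(3,4)])
      show "0 \<le> 2 * \<kappa>" using \<open>\<kappa> > 0\<close> by simp
      show "norm (a i x - a i y) \<le> L * dist x y" if "i \<in> J" for i
        using elim(2) le that unfolding x_def y_def dist_norm[symmetric] by (meson order_trans)
      show "\<bar>c i x - c i y\<bar> \<le> L * dist x y" if "i \<in> J" for i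
        using elim(3) le that unfolding x_def y_def dist_real_def[symmetric] by (meson order_trans)
      show "norm (d x - d y) \<le> L * dist x y"
        using elim(4) le unfolding x_def y_def dist_norm[symmetric] by (meson order_trans)
    qed (use \<nu>(1) \<nu>'(1) in auto)
    then show ?case unfolding x_def y_def dist_norm[symmetric] by (simp add: mult.assoc)
  qed
  then have "lipschitz_near g p" by (intro lipschitz_nearI)
  moreover have "g = (\<lambda>x. closest_point (halfspaces J (\<lambda>i. a i x) (\<lambda>i. c i x)) (d x))"
    by (rule ext) (simp only: g_def K_def)
  ultimately show ?thesis by (rule back_subst[where P = "\<lambda>g. lipschitz_near g p"])
qed

text \<open>
  At \<open>p\<close> dropping the inactive constraints does not change the projection, since their multipliers
  vanish. Because the projection \<open>g\<close> for the remaining constraints is continuous at \<open>p\<close>, the dropped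
  constraints still hold at \<open>g x\<close> for \<open>x\<close> near \<open>p\<close>; there \<open>g x\<close> lies in the smaller set and is
  therefore its closest point as well.
\<close>

lemma lipschitz_near_closest_point_active:
  fixes a :: "'i \<Rightarrow> 'p::metric_space \<Rightarrow> 'v::euclidean_space"
    and c :: "'i \<Rightarrow> 'p \<Rightarrow> real" and d :: "'p \<Rightarrow> 'v"
  defines "K \<equiv> \<lambda>J x. halfspaces J (\<lambda>i. a i x) (\<lambda>i. c i x)"
  assumes "finite I"
    and a: "\<And>i. i \<in> I \<Longrightarrow> (a i \<longlongrightarrow> a i p) (nhds p)"
    and c: "\<And>i. i \<in> I \<Longrightarrow> (c i \<longlongrightarrow> c i p) (nhds p)"
    and feas: "\<forall>\<^sub>F x in nhds p. K I x \<noteq> {}"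
    and A: "A = {i\<in>I. a i p \<bullet> closest_point (K I p) (d p) + c i p = 0}"
    and lip: "lipschitz_near (\<lambda>x. closest_point (K A x) (d x)) p"
  shows "lipschitz_near (\<lambda>x. closest_point (K I x) (d x)) p"
proof -
  define g where "g x = closest_point (K A x) (d x)" for x
  have "A \<subseteq> I" using A by blast
  then have sub: "K I x \<subseteq> K A x" for x by (auto simp: K_def halfspaces_def)
  define x0 where "x0 = closest_point (K I p) (d p)"
  have ne: "K I p \<noteq> {}" using feas by (rule eventually_nhds_x_imp_x)
  have x0: "x0 \<in> K I p"
    unfolding x0_def using ne by (intro closest_point_in_set) (simp_all add: K_def closed_halfspaces)
  obtain \<nu> where \<nu>: "\<forall>i\<in>I. 0 \<le> \<nu> i \<and> \<nu> i * (a i p \<bullet> x0 + c i p) = 0"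
    and eq: "x0 = d p + (\<Sum>i\<in>I. \<nu> i *\<^sub>R a i p)"
    using closest_point_halfspaces_KKT[OF \<open>finite I\<close> ne[unfolded K_def] x0_def[unfolded K_def]]
    by (elim exE conjE) (rule that)
  have "g p = x0"
    unfolding g_def K_def
  proof (rule KKT_imp_closest_point)
    show "x0 \<in> halfspaces A (\<lambda>i. a i p) (\<lambda>i. c i p)" using x0 sub by (auto simp: K_def)
    show "0 \<le> \<nu> i \<and> \<nu> i * (a i p \<bullet> x0 + c i p) = 0" if "i \<in> A" for i
      using \<nu> that \<open>A \<subseteq> I\<close> by blast
    have "(\<Sum>i\<in>A. \<nu> i *\<^sub>R a i p) = (\<Sum>i\<in>I. \<nu> i *\<^sub>R a i p)"
    proof (rule sum.mono_neutral_left[OF \<open>finite I\<close> \<open>A \<subseteq> I\<close>], rule ballI)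
      fix i assume "i \<in> I - A"
      then have "a i p \<bullet> x0 + c i p \<noteq> 0" "\<nu> i * (a i p \<bullet> x0 + c i p) = 0"
        using \<nu> by (auto simp: A x0_def)
      then show "\<nu> i *\<^sub>R a i p = 0" by simp
    qed
    then show "x0 = d p + (\<Sum>i\<in>A. \<nu> i *\<^sub>R a i p)" using eq by simp
  qed
  have "\<forall>\<^sub>F x in nhds p. \<forall>i\<in>I - A. 0 < a i x \<bullet> g x + c i x"
  proof (rule eventually_ball_finite)
    show "\<forall>i\<in>I - A. \<forall>\<^sub>F x in nhds p. 0 < a i x \<bullet> g x + c i x"
    proof
      fix i assume i: "i \<in> I - A"
      have "((\<lambda>x. a i x \<bullet> g x + c i x) \<longlongrightarrow> a i p \<bullet> g p + c i p) (nhds p)"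
        using lipschitz_near_imp_tendsto[OF lip] a[of i] c[of i] i
        unfolding g_def by (intro tendsto_intros) auto
      moreover have "0 < a i p \<bullet> g p + c i p"
        using i x0 unfolding \<open>g p = x0\<close> by (force simp: A x0_def K_def halfspaces_def)
      ultimately show "\<forall>\<^sub>F x in nhds p. 0 < a i x \<bullet> g x + c i x" by (rule order_tendstoD(1))
    qed
  qed (use \<open>finite I\<close> in simp)
  with feas have "\<forall>\<^sub>F x in nhds p. g x = closest_point (K I x) (d x)"
  proof eventually_elim
    case (elim x)
    have clA: "closed (K A x)" by (simp add: K_def closed_halfspaces)
    have "g x \<in> K A x"
      unfolding g_def using elim(1) sub[of x] by (intro closest_point_in_set[OF clA]) auto
    have "g x \<in> K I x" unfolding K_def halfspaces_def
    proof (intro CollectI ballI)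
      fix i assume "i \<in> I"
      then show "0 \<le> a i x \<bullet> g x + c i x"
        using \<open>g x \<in> K A x\<close> elim(2) by (cases "i \<in> A") (auto simp: K_def halfspaces_def less_imp_le)
    qed
    moreover have "\<forall>q\<in>K I x. dist (d x) (g x) \<le> dist (d x) q"
      unfolding g_def using sub[of x] by (auto intro: closest_point_le[OF clA])
    ultimately show ?case
      by (intro closest_point_unique) (auto simp: K_def closed_halfspaces convex_halfspaces)
  qed
  with lip show ?thesis unfolding g_def by (rule lipschitz_near_transform)
qed

text \<open>
  With at most two constraints, a dependent active family consists of two parallel nonzero
  normals. The Slater point \<open>q\<close> is used three times: it makes the problem feasible near \<open>p\<close>, it
  excludes zero normals of active constraints, and it excludes opposite normals.
\<close>

lemma lipschitz_near_closest_point_constant_rank: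
  fixes a :: "'i \<Rightarrow> 'p::metric_space \<Rightarrow> 'v::euclidean_space"
    and c :: "'i \<Rightarrow> 'p \<Rightarrow> real" and d :: "'p \<Rightarrow> 'v"
  defines "K \<equiv> \<lambda>J x. halfspaces J (\<lambda>i. a i x) (\<lambda>i. c i x)"
  assumes "finite I" "card I \<le> 2"
    and a: "\<And>i. i \<in> I \<Longrightarrow> lipschitz_near (a i) p"
    and c: "\<And>i. i \<in> I \<Longrightarrow> lipschitz_near (c i) p"
    and d: "lipschitz_near d p"
    and slater: "\<And>i. i \<in> I \<Longrightarrow> 0 < a i p \<bullet> q + c i p"
    and A: "A = {i\<in>I. a i p \<bullet> closest_point (K I p) (d p) + c i p = 0}"
    and rank: "\<And>J. J \<subseteq> A \<Longrightarrow>
       \<forall>\<^sub>F x in nhds p. dim ((\<lambda>i. a i x) ` J) = dim ((\<lambda>i. a i p) ` J)"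
  shows "lipschitz_near (\<lambda>x. closest_point (K I x) (d x)) p"
proof -
  have a0: "(a i \<longlongrightarrow> a i p) (nhds p)" and c0: "(c i \<longlongrightarrow> c i p) (nhds p)" if "i \<in> I" for i
    using a c that by (auto intro: lipschitz_near_imp_tendsto)
  have "\<forall>\<^sub>F x in nhds p. \<forall>i\<in>I. 0 < a i x \<bullet> q + c i x"
  proof (rule eventually_ball_finite[OF \<open>finite I\<close>], rule ballI)
    fix i assume i: "i \<in> I"
    have "((\<lambda>x. a i x \<bullet> q + c i x) \<longlongrightarrow> a i p \<bullet> q + c i p) (nhds p)"
      using a0[OF i] c0[OF i] by (intro tendsto_intros)
    from order_tendstoD(1)[OF this slater[OF i]]
    show "\<forall>\<^sub>F x in nhds p. 0 < a i x \<bullet> q + c i x" .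
  qed
  then have q: "\<forall>\<^sub>F x in nhds p. q \<in> K I x"
    by (rule eventually_mono) (auto simp: K_def halfspaces_def less_imp_le)
  have feas: "\<forall>\<^sub>F x in nhds p. K I x \<noteq> {}" using q by (rule eventually_mono) blast
  define x0 where "x0 = closest_point (K I p) (d p)"
  have "A \<subseteq> I" using A by blast
  have step: "0 < a i p \<bullet> (q - x0)" if "i \<in> A" for i
    using slater[of i] that by (simp add: A x0_def inner_diff_right)
  have nz: "a i p \<noteq> 0" if "i \<in> A" for i using step[OF that] by auto
  have "lipschitz_near (\<lambda>x. closest_point (K A x) (d x)) p"
  proof (cases "\<forall>i\<in>A. a i p \<notin> span ((\<lambda>j. a j p) ` (A - {i}))")
    case True
    show ?thesis unfolding K_def
    proof (rule lipschitz_near_closest_point_independent)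
      show "\<forall>\<^sub>F x in nhds p. q \<in> halfspaces A (\<lambda>i. a i x) (\<lambda>i. c i x)"
        using q \<open>A \<subseteq> I\<close> unfolding K_def by (elim eventually_mono) (auto simp: halfspaces_def)
    qed (use True \<open>A \<subseteq> I\<close> \<open>finite I\<close> a c d in \<open>auto intro: finite_subset\<close>)
  next
    case False
    then obtain j where j: "j \<in> A" "a j p \<in> span ((\<lambda>i. a i p) ` (A - {j}))" by blast
    have "A - {j} \<noteq> {}"
    proof
      assume "A - {j} = {}"
      with j(2) have "a j p \<in> span {}" by (simp only: image_empty)
      with nz[OF j(1)] show False by simp
    qed
    then obtain i where i: "i \<in> A" "i \<noteq> j" by blast
    have "A = {i, j}"
    proof (rule card_seteq[symmetric])
      show "finite A" using \<open>finite I\<close> \<open>A \<subseteq> I\<close> by (rule rev_finite_subset)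
      have "card A \<le> card I" using \<open>finite I\<close> \<open>A \<subseteq> I\<close> by (rule card_mono)
      then show "card A \<le> card {i, j}" using \<open>card I \<le> 2\<close> i by simp
    qed (use i j in auto)
    \<comment> \<open>Since \<open>\<sigma> *\<^sub>R a j = \<tau> *\<^sub>R a i\<close> for parallel normals, scaling the two constraints by the
      positive numbers \<open>\<tau>\<close> and \<open>\<sigma>\<close> gives both the normal \<open>\<tau> *\<^sub>R a i\<close>; the smaller offset decides.\<close>
    define \<tau> where "\<tau> x = a i x \<bullet> a j x" for x
    define \<sigma> where "\<sigma> x = a i x \<bullet> a i x" for x
    define c' where "c' x = min (\<tau> x * c i x) (\<sigma> x * c j x)" for x
    have lip: "lipschitz_near (a i) p" "lipschitz_near (a j) p" "lipschitz_near (c i) p" "lipschitz_near (c j) p"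
      using i j \<open>A \<subseteq> I\<close> a c by auto
    have lip\<tau>: "lipschitz_near \<tau> p" and lip\<sigma>: "lipschitz_near \<sigma> p"
      unfolding \<tau>_def[abs_def] \<sigma>_def[abs_def]
      by (intro lipschitz_near_bilinear[OF bounded_bilinear_inner] lip)+
    have lipn: "lipschitz_near (\<lambda>x. \<tau> x *\<^sub>R a i x) p"
      by (intro lipschitz_near_bilinear[OF bounded_bilinear_scaleR] lip\<tau> lip)
    have lipc: "lipschitz_near c' p"
      unfolding c'_def[abs_def]
      by (intro lipschitz_near_min lipschitz_near_bilinear[OF bounded_bilinear_mult] lip\<tau> lip\<sigma> lip)
    have colinear: "\<sigma> x *\<^sub>R a j x = \<tau> x *\<^sub>R a i x" if in_span: "a j x \<in> span {a i x}" for x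
    proof -
      obtain t where "a j x = t *\<^sub>R a i x" using in_span by (auto simp: span_singleton)
      then show ?thesis by (simp add: \<sigma>_def \<tau>_def)
    qed
    have jp: "a j p \<in> span {a i p}" using j(2) i(2) \<open>A = {i, j}\<close> by (simp add: insert_Diff_if)
    have dim1: "dim {a i p, a j p} = 1"
      using jp nz[OF i(1)] by (simp add: dim_insert insert_commute[of "a i p"])
    have "\<forall>\<^sub>F x in nhds p. dim {a i x, a j x} = 1"
      using rank[of A] dim1 \<open>A = {i, j}\<close> by simp
    moreover have "\<forall>\<^sub>F x in nhds p. 0 < \<sigma> x"
      using lipschitz_near_imp_tendsto[OF lip\<sigma>] nz[OF i(1)] by (elim order_tendstoD(1)) (simp add: \<sigma>_def)
    moreover have "0 < \<tau> p"
    proof -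
      have "0 < \<sigma> p * (a j p \<bullet> (q - x0))" using step[OF j(1)] nz[OF i(1)] by (simp add: \<sigma>_def)
      also have "\<dots> = \<tau> p * (a i p \<bullet> (q - x0))"
        using colinear[OF jp] by (metis inner_scaleR_left)
      finally show ?thesis using step[OF i(1)] by (simp add: zero_less_mult_iff)
    qed
    with lipschitz_near_imp_tendsto[OF lip\<tau>] have "\<forall>\<^sub>F x in nhds p. 0 < \<tau> x"
      by (rule order_tendstoD(1))
    ultimately have KA: "\<forall>\<^sub>F x in nhds p. K A x = halfspaces {()} (\<lambda>_. \<tau> x *\<^sub>R a i x) (\<lambda>_. c' x)"
    proof eventually_elim
      case (elim x)
      have "a i x \<noteq> 0" using elim(2) by (auto simp: \<sigma>_def)
      have "a j x \<in> span {a i x}"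
      proof (rule ccontr)
        assume "a j x \<notin> span {a i x}"
        then have "dim {a j x, a i x} = 2" using \<open>a i x \<noteq> 0\<close> by (simp add: dim_insert)
        then show False using elim(1) by (simp add: insert_commute)
      qed
      note col = colinear[OF this]
      have "0 \<le> a i x \<bullet> y + c i x \<longleftrightarrow> 0 \<le> (\<tau> x *\<^sub>R a i x) \<bullet> y + \<tau> x * c i x" for y
        using elim(3) by (simp add: distrib_left[symmetric] zero_le_mult_iff)
      moreover have "0 \<le> a j x \<bullet> y + c j x \<longleftrightarrow> 0 \<le> (\<tau> x *\<^sub>R a i x) \<bullet> y + \<sigma> x * c j x" for y
        unfolding col[symmetric] using elim(2) by (simp add: distrib_left[symmetric] zero_le_mult_iff)
      ultimately show ?case unfolding \<open>A = {i, j}\<close> K_def halfspaces_def c'_def by auto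
    qed
    have "lipschitz_near (\<lambda>x. closest_point (halfspaces {()} (\<lambda>_. \<tau> x *\<^sub>R a i x) (\<lambda>_. c' x)) (d x)) p"
    proof (rule lipschitz_near_closest_point_independent)
      show "\<forall>\<^sub>F x in nhds p. q \<in> halfspaces {()} (\<lambda>_. \<tau> x *\<^sub>R a i x) (\<lambda>_. c' x)"
        using KA q
      proof eventually_elim
        case (elim x)
        then show ?case using \<open>A \<subseteq> I\<close> by (auto simp: K_def halfspaces_def)
      qed
    qed (use lipn lipc d \<open>0 < \<tau> p\<close> nz[OF i(1)] in auto)
    then show ?thesis
      by (rule lipschitz_near_transform) (use KA in \<open>auto elim: eventually_mono\<close>)
  qed
  then show ?thesis
    unfolding K_def
    by (intro lipschitz_near_closest_point_active[of I a p c A d] \<open>finite I\<close> a0 c0)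
       (use feas A in \<open>simp_all add: K_def\<close>)
qed


section \<open>Calculus of continuously differentiable functions\<close>

lemma Ck_Suc_imp_Ck: "Ck (Suc k) f \<Longrightarrow> Ck k f"
proof (induction k arbitrary: f)
  case 0
  then show ?case
    by (auto intro!: continuous_at_imp_continuous_on differentiable_imp_continuous_within)
next
  case (Suc k)
  then show ?case by (simp only: Ck.simps) blast
qed

lemma Ck_mono: "Ck n f \<Longrightarrow> k \<le> n \<Longrightarrow> Ck k f"
  by (induction n rule: nat.induct) (auto simp: le_Suc_eq simp del: Ck.simps dest: Ck_Suc_imp_Ck)

lemma Ck_SucI:
  assumes "\<And>x. (f has_derivative D x) (at x)" and "\<And>v. Ck k (\<lambda>x. D x v)"
  shows "Ck (Suc k) f"
  using assms by (auto simp: differentiable_def frechet_derivative_at[OF assms(1), symmetric])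

lemma Ck_SucD:
  assumes "Ck (Suc k) f"
  shows "(f has_derivative frechet_derivative f (at x)) (at x)"
    and "Ck k (\<lambda>x. frechet_derivative f (at x) v)"
  using assms by (auto simp: frechet_derivative_works[symmetric])

lemma Ck_const: "Ck k (\<lambda>x. c)"
proof (induction k arbitrary: c)
  case (Suc k)
  show ?case by (rule Ck_SucI[where D = "\<lambda>x v. 0"]) (auto intro: Suc)
qed simp

lemma Ck_add: "Ck k f \<Longrightarrow> Ck k g \<Longrightarrow> Ck k (\<lambda>x. f x + g x)"
proof (induction k arbitrary: f g)
  case 0
  then show ?case by (auto intro: continuous_intros)
next
  case (Suc k)
  show ?case
    by (rule Ck_SucI, rule has_derivative_add[OF Ck_SucD(1)[OF Suc.prems(1)] Ck_SucD(1)[OF Suc.prems(2)]])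
       (intro Suc.IH Ck_SucD(2)[OF Suc.prems(1)] Ck_SucD(2)[OF Suc.prems(2)])
qed

lemma Ck_sum: "(\<And>i. i \<in> I \<Longrightarrow> Ck k (f i)) \<Longrightarrow> Ck k (\<lambda>x. \<Sum>i\<in>I. f i x)"
  by (induction I rule: infinite_finite_induct) (auto intro: Ck_const Ck_add)

lemma Ck_bilinear:
  fixes f :: "'a::euclidean_space \<Rightarrow> 'b::euclidean_space" and g :: "'a \<Rightarrow> 'c::euclidean_space"
    and pr :: "'b \<Rightarrow> 'c \<Rightarrow> 'd::euclidean_space"
  assumes pr: "bounded_bilinear pr"
  shows "Ck k f \<Longrightarrow> Ck k g \<Longrightarrow> Ck k (\<lambda>x. pr (f x) (g x))"
proof (induction k arbitrary: f g)
  case 0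
  then show ?case by (auto intro: bounded_bilinear.continuous_on[OF pr])
next
  case (Suc k)
  show ?case
    by (rule Ck_SucI, rule bounded_bilinear.FDERIV[OF pr Ck_SucD(1)[OF Suc.prems(1)] Ck_SucD(1)[OF Suc.prems(2)]])
       (intro Ck_add Suc.IH Ck_SucD(2)[OF Suc.prems(1)] Ck_SucD(2)[OF Suc.prems(2)]
          Ck_Suc_imp_Ck[OF Suc.prems(1)] Ck_Suc_imp_Ck[OF Suc.prems(2)])
qed

lemma Ck_compose_linear:
  fixes f :: "'a::euclidean_space \<Rightarrow> 'b::euclidean_space" and A :: "'c::euclidean_space \<Rightarrow> 'a"
  assumes A: "linear A"
  shows "Ck k f \<Longrightarrow> Ck k (\<lambda>x. f (A x))"
proof (induction k arbitrary: f)
  case 0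
  then show ?case using linear_continuous_on[of A UNIV] A
    by (auto simp: linear_conv_bounded_linear intro: continuous_on_compose2)
next
  case (Suc k)
  have dA: "(A has_derivative A) (at x)" for x
    using A by (simp add: linear_conv_bounded_linear bounded_linear_imp_has_derivative)
  show ?case
    by (rule Ck_SucI, rule has_derivative_compose[OF dA Ck_SucD(1)[OF Suc.prems]])
       (intro Suc.IH Ck_SucD(2)[OF Suc.prems])
qed

lemma Ck_vec:
  fixes g :: "'n::finite \<Rightarrow> 'a::euclidean_space \<Rightarrow> real"
  assumes "\<And>i. Ck k (g i)"
  shows "Ck k (\<lambda>x. \<chi> i. g i x)"
proof -
  have "(\<lambda>x. \<chi> i. g i x) = (\<lambda>x. \<Sum>i\<in>UNIV. g i x *\<^sub>R (axis i 1 :: real^'n))"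
    by (auto simp: fun_eq_iff vec_eq_iff axis_def sum.delta if_distrib cong: if_cong)
  moreover have "Ck k \<dots>"
    by (intro Ck_sum Ck_bilinear[OF bounded_bilinear_scaleR] assms Ck_const)
  ultimately show ?thesis by (simp only:)
qed

lemma Ck_grad: "Ck (Suc k) \<phi> \<Longrightarrow> Ck k (grad \<phi>)"
  unfolding grad_def[abs_def] by (intro Ck_vec Ck_SucD(2))

lemma grad_x_eq:
  assumes "\<phi> differentiable at p"
  shows "grad_x \<phi> p = (\<chi> i. frechet_derivative \<phi> (at p) (axis i 1, 0))"
proof -
  have "((\<lambda>x. \<phi> (x, snd p)) has_derivative (\<lambda>v. frechet_derivative \<phi> (at p) (v, 0))) (at (fst p))"
  proof (rule has_derivative_compose[where f = "\<lambda>x. (x, snd p)"])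
    show "((\<lambda>x. (x, snd p)) has_derivative (\<lambda>v. (v, 0))) (at (fst p))"
      by (auto intro!: derivative_eq_intros)
    show "(\<phi> has_derivative frechet_derivative \<phi> (at p)) (at (fst p, snd p))"
      using assms by (simp add: frechet_derivative_works[symmetric])
  qed
  from frechet_derivative_at[OF this, symmetric] show ?thesis
    by (simp add: grad_x_def grad_def)
qed

lemma grad_u_eq:
  assumes "\<phi> differentiable at p"
  shows "grad_u \<phi> p = (\<chi> i. frechet_derivative \<phi> (at p) (0, axis i 1))"
proof -
  have "((\<lambda>u. \<phi> (fst p, u)) has_derivative (\<lambda>v. frechet_derivative \<phi> (at p) (0, v))) (at (snd p))"
  proof (rule has_derivative_compose[where f = "\<lambda>u. (fst p, u)"])
    show "((\<lambda>u. (fst p, u)) has_derivative (\<lambda>v. (0, v))) (at (snd p))"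
      by (auto intro!: derivative_eq_intros)
    show "(\<phi> has_derivative frechet_derivative \<phi> (at p)) (at (fst p, snd p))"
      using assms by (simp add: frechet_derivative_works[symmetric])
  qed
  from frechet_derivative_at[OF this, symmetric] show ?thesis
    by (simp add: grad_u_def grad_def)
qed

lemma Ck_grad_x: "Ck (Suc k) \<phi> \<Longrightarrow> Ck k (grad_x \<phi>)"
proof -
  assume \<phi>: "Ck (Suc k) \<phi>"
  then have "grad_x \<phi> = (\<lambda>p. \<chi> i. frechet_derivative \<phi> (at p) (axis i 1, 0))"
    by (auto simp: grad_x_eq fun_eq_iff)
  moreover have "Ck k \<dots>" using \<phi> by (intro Ck_vec Ck_SucD(2))
  ultimately show ?thesis by (simp only:)
qed

lemma Ck_grad_u: "Ck (Suc k) \<phi> \<Longrightarrow> Ck k (grad_u \<phi>)"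
proof -
  assume \<phi>: "Ck (Suc k) \<phi>"
  then have "grad_u \<phi> = (\<lambda>p. \<chi> i. frechet_derivative \<phi> (at p) (0, axis i 1))"
    by (auto simp: grad_u_eq fun_eq_iff)
  moreover have "Ck k \<dots>" using \<phi> by (intro Ck_vec Ck_SucD(2))
  ultimately show ?thesis by (simp only:)
qed

text \<open>
  Each step of the recursion differentiates once and so costs one order. The factor \<open>f\<close> never
  limits the result, because \<open>h\<close> has only one order more than \<open>f\<close> and loses it in the first step.
\<close>

lemma Ck_h_seq:
  assumes f: "Ck (r + 1) f" and h: "Ck (r + 2) h"
  shows "i \<le> r \<Longrightarrow> Ck (r + 2 - i) (h_seq f h \<beta> i)"
proof (induction i)
  case 0
  have "Ck (r + 2) (\<lambda>p. h (fst p))"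
    using h by (rule Ck_compose_linear[OF linear_fst])
  then show ?case by simp
next
  case (Suc i)
  define k where "k = r + 2 - Suc i"
  have k: "r + 2 - i = Suc k" "k \<le> r + 1" using Suc.prems by (auto simp: k_def)
  have IH: "Ck (Suc k) (h_seq f h \<beta> i)" using Suc k by simp
  have "Ck k (\<lambda>p. grad_x (h_seq f h \<beta> i) p \<bullet> f p + \<beta> * h_seq f h \<beta> i p)"
    by (intro Ck_add Ck_bilinear[OF bounded_bilinear_inner] Ck_bilinear[OF bounded_bilinear_mult]
        Ck_const Ck_grad_x[OF IH] Ck_Suc_imp_Ck[OF IH] Ck_mono[OF f k(2)])
  then show ?case by (simp add: k_def)
qed

lemma Ck_jacobian_transpose:
  fixes w :: "real^'m \<Rightarrow> real^'n" and \<Phi> :: "real^'n \<Rightarrow> real"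
  assumes w: "Ck (Suc k) w" and \<Phi>: "Ck (Suc k) \<Phi>"
  shows "Ck k (\<lambda>p :: (real^'n) \<times> (real^'m). transpose (jacobian w (at (snd p))) *v grad \<Phi> (fst p))"
proof -
  have "(\<lambda>p. transpose (jacobian w (at (snd p))) *v grad \<Phi> (fst p)) =
      (\<lambda>p. \<chi> j. frechet_derivative w (at (snd p)) (axis j 1) \<bullet> grad \<Phi> (fst p))"
    by (simp add: fun_eq_iff vec_eq_iff matrix_vector_mult_def transpose_def jacobian_def matrix_def inner_vec_def)
  moreover have "Ck k \<dots>"
    by (intro Ck_vec Ck_bilinear[OF bounded_bilinear_inner]
        Ck_compose_linear[OF linear_snd Ck_SucD(2)[OF w]] Ck_compose_linear[OF linear_fst Ck_grad[OF \<Phi>]])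
  ultimately show ?thesis by (simp only:)
qed

text \<open>
  Continuity of the derivative is only known for one direction at a time. In finite dimension
  this is enough: bounds for the finitely many basis directions on a compact ball add up to a
  bound for the operator norm.
\<close>

lemma Ck_1_imp_lipschitz_near:
  fixes f :: "'a::euclidean_space \<Rightarrow> 'b::euclidean_space"
  assumes f: "Ck 1 f"
  shows "lipschitz_near f p"
proof -
  have d: "(f has_derivative frechet_derivative f (at x)) (at x)" for x
    using Ck_SucD(1)[of 0 f] f by simp
  have c: "continuous_on UNIV (\<lambda>x. frechet_derivative f (at x) v)" for v
    using Ck_SucD(2)[of 0 f] f by simp
  have "\<exists>B. \<forall>x\<in>cball p 1. norm (frechet_derivative f (at x) v) \<le> B" for v
  proof -
    have "compact ((\<lambda>x. frechet_derivative f (at x) v) ` cball p 1)"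
      using c by (intro compact_continuous_image) (auto intro: continuous_on_subset)
    from compact_imp_bounded[OF this] show ?thesis by (auto simp: bounded_iff)
  qed
  then obtain B where B: "\<And>v x. x \<in> cball p 1 \<Longrightarrow> norm (frechet_derivative f (at x) v) \<le> B v"
    by metis
  have B0: "0 \<le> B v" for v using B[of p v] norm_ge_zero order_trans by (metis centre_in_cball zero_le_one)
  have "(\<Sum>b\<in>Basis. B b)-lipschitz_on (ball p 1) f"
  proof (rule bounded_derivative_imp_lipschitz)
    fix x assume x: "x \<in> ball p 1"
    show "(f has_derivative frechet_derivative f (at x)) (at x within ball p 1)"
      using d by (rule has_derivative_at_withinI)
    interpret D: bounded_linear "frechet_derivative f (at x)" using d by (rule has_derivative_bounded_linear)
    show "onorm (frechet_derivative f (at x)) \<le> (\<Sum>b\<in>Basis. B b)"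
    proof (rule onorm_bound)
      fix v :: 'a
      have "frechet_derivative f (at x) v = (\<Sum>b\<in>Basis. (v \<bullet> b) *\<^sub>R frechet_derivative f (at x) b)"
        by (subst euclidean_representation[of v, symmetric]) (simp only: D.sum D.scaleR)
      also have "norm \<dots> \<le> (\<Sum>b\<in>Basis. norm v * B b)"
        using B[of x] x Basis_le_norm[of _ v]
        by (intro sum_norm_le) (auto intro!: mult_mono)
      also have "\<dots> = (\<Sum>b\<in>Basis. B b) * norm v" by (simp add: sum_distrib_left sum_distrib_right mult.commute)
      finally show "norm (frechet_derivative f (at x) v) \<le> (\<Sum>b\<in>Basis. B b) * norm v" .
    qed (simp add: sum_nonneg B0)
  qed (auto intro: sum_nonneg B0)
  then show ?thesis unfolding lipschitz_near_iff_ball by (intro exI[of _ 1] conjI exI) auto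
qed


section \<open>Ordinary differential equations with a Lipschitz right-hand side\<close>

text \<open>
  Banach's fixed point theorem on the space of bounded continuous functions. These functions live
  on the whole line, so the Picard operator is evaluated on \<open>[0, T]\<close> and its result is extended by
  constants; on \<open>[0, T]\<close> a fixed point satisfies the integral equation.
\<close>

lemma picard_lipschitz:
  fixes G :: "'a::euclidean_space \<Rightarrow> 'a"
  assumes lip: "L-lipschitz_on UNIV G"
  shows "\<exists>T>0. \<exists>\<phi>. \<phi> 0 = x0 \<and>
           (\<forall>t\<in>{0..T}. (\<phi> has_vector_derivative G (\<phi> t)) (at t within {0..T}))"
proof -
  have L0: "0 \<le> L" using lip by (rule lipschitz_on_nonneg)
  \<comment> \<open>Short enough for the Picard operator to be a contraction with factor \<open>1/2\<close>; the
    summand \<open>1\<close> covers \<open>L = 0\<close>.\<close>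
  define T where "T = 1 / (2 * (L + 1))"
  have T: "0 < T" "L * T \<le> 1 / 2" using L0 by (auto simp: T_def field_simps)
  have contG: "continuous_on S (\<lambda>t. G (apply_bcontfun x t))" for x and S :: "real set"
    using lipschitz_on_continuous_on[OF lip]
    by (rule continuous_on_compose2) auto
  define Q where "Q x t = x0 + integral {0..t} (\<lambda>s. G (apply_bcontfun x s))" for x and t :: real
  have "continuous_on (cbox 0 T) (Q x)" for x
    unfolding Q_def[abs_def] cbox_interval
    by (intro continuous_intros indefinite_integral_continuous_1 integrable_continuous_real contG)
  then have "\<exists>g. (\<forall>t\<in>cbox 0 T. apply_bcontfun g t = Q x t) \<and> (\<forall>t. apply_bcontfun g t = Q x (clamp 0 T t))"
    for x :: "real \<Rightarrow>\<^sub>C 'a"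
    by (metis continuous_on_cbox_bcontfunE)
  then obtain P :: "(real \<Rightarrow>\<^sub>C 'a) \<Rightarrow> (real \<Rightarrow>\<^sub>C 'a)"
    where P: "\<And>x t. t \<in> cbox 0 T \<Longrightarrow> apply_bcontfun (P x) t = Q x t"
      and P': "\<And>x t. apply_bcontfun (P x) t = Q x (clamp 0 T t)"
    by metis
  have "dist (P x) (P y) \<le> 1 / 2 * dist x y" for x y
  proof (rule dist_bound)
    fix t
    define \<tau> where "\<tau> = clamp 0 T t"
    have \<tau>: "0 \<le> \<tau>" "\<tau> \<le> T" using clamp_in_interval[of 0 T t] T(1) by (auto simp: \<tau>_def)
    have "Q x \<tau> - Q y \<tau> = integral {0..\<tau>} (\<lambda>s. G (apply_bcontfun x s) - G (apply_bcontfun y s))"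
      unfolding Q_def by (subst integral_diff) (auto intro!: integrable_continuous_real contG)
    also have "norm \<dots> \<le> (L * dist x y) * (\<tau> - 0)"
    proof (rule integral_bound[OF \<tau>(1)])
      show "continuous_on {0..\<tau>} (\<lambda>s. G (apply_bcontfun x s) - G (apply_bcontfun y s))"
        by (intro continuous_intros contG)
      fix s
      have "norm (G (apply_bcontfun x s) - G (apply_bcontfun y s)) \<le> L * dist (apply_bcontfun x s) (apply_bcontfun y s)"
        using lipschitz_onD[OF lip] by (simp add: dist_norm)
      also have "\<dots> \<le> L * dist x y" using L0 by (intro mult_left_mono dist_bounded)
      finally show "norm (G (apply_bcontfun x s) - G (apply_bcontfun y s)) \<le> L * dist x y" .
    qed
    also have "\<dots> \<le> (L * dist x y) * T" using \<tau> L0 by (intro mult_left_mono) auto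
    also have "\<dots> = (L * T) * dist x y" by simp
    also have "\<dots> \<le> 1 / 2 * dist x y" using T(2) by (intro mult_right_mono) auto
    finally show "dist (apply_bcontfun (P x) t) (apply_bcontfun (P y) t) \<le> 1 / 2 * dist x y"
      by (simp add: P' \<tau>_def dist_norm)
  qed
  then have "\<exists>!x. P x = x" by (intro banach_fix_type[of "1/2"]) auto
  then obtain x where x: "P x = x" by blast
  define \<phi> where "\<phi> = apply_bcontfun x"
  have \<phi>: "\<phi> t = Q x t" if "t \<in> {0..T}" for t
    using P[of t x] that by (simp add: x \<phi>_def)
  have "(\<phi> has_vector_derivative G (\<phi> t)) (at t within {0..T})" if t: "t \<in> {0..T}" for t
  proof -
    have "(Q x has_vector_derivative 0 + G (\<phi> t)) (at t within {0..T})"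
      unfolding Q_def[abs_def] \<phi>_def
      by (intro has_vector_derivative_add has_vector_derivative_const
          integral_has_vector_derivative[OF contG t])
    then have "(Q x has_vector_derivative G (\<phi> t)) (at t within {0..T})" by simp
    with t \<phi> show ?thesis by (rule has_vector_derivative_transform)
  qed
  moreover have "\<phi> 0 = x0" using \<phi>[of 0] T(1) by (simp add: Q_def)
  ultimately show ?thesis using T(1) by blast
qed

text \<open>
  On an interval of length at most \<open>1 / (2 (L + 1))\<close> the largest distance \<open>M\<close> between the two
  solutions satisfies \<open>M \<le> M / 2\<close>, by the mean value inequality.
\<close>

lemma ode_solutions_agree_near:
  fixes F :: "'a::euclidean_space \<Rightarrow> 'a" and \<phi> \<psi> :: "real \<Rightarrow> 'a"
  assumes lip: "L-lipschitz_on U F" and "open U" and "convex S"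
    and \<phi>: "\<And>t. t \<in> S \<Longrightarrow> (\<phi> has_vector_derivative F (\<phi> t)) (at t within S)"
    and \<psi>: "\<And>t. t \<in> S \<Longrightarrow> (\<psi> has_vector_derivative F (\<psi> t)) (at t within S)"
    and s: "s \<in> S" "\<phi> s = \<psi> s" "\<phi> s \<in> U"
  shows "\<forall>\<^sub>F t in at s within S. \<phi> t = \<psi> t"
proof -
  have L0: "0 \<le> L" using lip by (rule lipschitz_on_nonneg)
  have cont: "continuous_on S \<phi>" "continuous_on S \<psi>"
    by (rule continuous_on_vector_derivative, erule \<phi>) (rule continuous_on_vector_derivative, erule \<psi>)
  then have "(\<phi> \<longlongrightarrow> \<phi> s) (at s within S)" "(\<psi> \<longlongrightarrow> \<psi> s) (at s within S)"
    using s(1) by (auto simp: continuous_on_def)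
  then have "\<forall>\<^sub>F t in at s within S. \<phi> t \<in> U \<and> \<psi> t \<in> U"
    using s \<open>open U\<close> by (intro eventually_conj topological_tendstoD) auto
  then obtain \<eta>0 where \<eta>0: "\<eta>0 > 0" "\<And>t. t \<in> S \<Longrightarrow> dist t s < \<eta>0 \<Longrightarrow> \<phi> t \<in> U \<and> \<psi> t \<in> U"
    using s unfolding eventually_at by (metis)
  define \<eta> where "\<eta> = min \<eta>0 (1 / (2 * (L + 1)))"
  have \<eta>: "0 < \<eta>" "\<eta> \<le> \<eta>0" "L * \<eta> \<le> 1 / 2"
  proof -
    show "0 < \<eta>" "\<eta> \<le> \<eta>0" using \<eta>0 L0 by (auto simp: \<eta>_def)
    have "L * \<eta> \<le> L * (1 / (2 * (L + 1)))" using L0 by (intro mult_left_mono) (auto simp: \<eta>_def)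
    also have "\<dots> \<le> 1 / 2" using L0 by (simp add: field_simps)
    finally show "L * \<eta> \<le> 1 / 2" .
  qed
  have "\<phi> t = \<psi> t" if t: "t \<in> S" "dist t s < \<eta>" for t
  proof -
    define K where "K = closed_segment s t"
    have KS: "K \<subseteq> S" unfolding K_def using closed_segment_subset[OF s(1) t(1) \<open>convex S\<close>] .
    have Kd: "dist u s < \<eta>" if "u \<in> K" for u
      using that t(2) by (auto simp: K_def dist_real_def closed_segment_eq_real_ivl split: if_splits)
    have contK: "continuous_on K (\<lambda>u. norm (\<phi> u - \<psi> u))"
      by (intro continuous_intros continuous_on_subset[OF cont(1) KS] continuous_on_subset[OF cont(2) KS])
    have "compact K" "K \<noteq> {}" by (auto simp: K_def)
    from continuous_attains_sup[OF this contK]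
    obtain u where u: "u \<in> K" "\<And>v. v \<in> K \<Longrightarrow> norm (\<phi> v - \<psi> v) \<le> norm (\<phi> u - \<psi> u)"
      by blast
    define M where "M = norm (\<phi> u - \<psi> u)"
    have "norm ((\<phi> u - \<psi> u) - (\<phi> s - \<psi> s)) \<le> (L * M) * norm (u - s)"
    proof (rule differentiable_bound[where S = K])
      show "convex K" "u \<in> K" "s \<in> K" using u by (auto simp: K_def)
      fix v assume v: "v \<in> K"
      have "((\<lambda>v. \<phi> v - \<psi> v) has_vector_derivative F (\<phi> v) - F (\<psi> v)) (at v within K)"
        using v KS \<phi> \<psi>
        by (intro has_vector_derivative_diff) (meson has_vector_derivative_within_subset subsetD)+
      then show "((\<lambda>v. \<phi> v - \<psi> v) has_derivative (\<lambda>h. h *\<^sub>R (F (\<phi> v) - F (\<psi> v)))) (at v within K)"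
        by (simp only: has_vector_derivative_def)
      have "norm (F (\<phi> v) - F (\<psi> v)) \<le> L * norm (\<phi> v - \<psi> v)"
        using \<eta>0(2)[of v] v KS Kd[OF v] \<eta>(2) lipschitz_onD[OF lip, of "\<phi> v" "\<psi> v"]
        by (auto simp: dist_norm)
      also have "\<dots> \<le> L * M" using u(2)[OF v] L0 unfolding M_def by (intro mult_left_mono)
      finally have "norm (F (\<phi> v) - F (\<psi> v)) \<le> L * M" .
      then show "onorm (\<lambda>h. h *\<^sub>R (F (\<phi> v) - F (\<psi> v))) \<le> L * M"
        by (intro onorm_bound) (auto simp: M_def L0 mult.commute[of _ "\<bar>_\<bar>"] intro: mult_left_mono)
    qed
    then have "M \<le> (L * M) * norm (u - s)" using s(2) by (simp add: M_def)
    also have "\<dots> \<le> (L * M) * \<eta>"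
      using Kd[OF u(1)] L0 by (intro mult_left_mono) (auto simp: M_def dist_real_def)
    also have "\<dots> = (L * \<eta>) * M" by simp
    also have "\<dots> \<le> 1 / 2 * M" using \<eta>(3) by (intro mult_right_mono) (auto simp: M_def)
    finally have "M \<le> 0" by simp
    moreover have "norm (\<phi> t - \<psi> t) \<le> M" unfolding M_def by (intro u(2)) (simp add: K_def)
    ultimately have "norm (\<phi> t - \<psi> t) \<le> 0" by linarith
    then show ?thesis by simp
  qed
  then show ?thesis unfolding eventually_at using \<eta>(1) by blast
qed

text \<open>
  Composing \<open>F\<close> with the projection onto a smaller closed ball makes it globally Lipschitz without
  changing it on that ball, in which the solution remains for a while. A competing solution may
  leave the ball, but not before the two disagree: agreement is a locally constant property of
  time on the common interval.
\<close>

lemma ode_unique_solution: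
  fixes F :: "'a::euclidean_space \<Rightarrow> 'a"
  assumes "0 < \<delta>" and D: "ball p0 \<delta> \<subseteq> D" and lip: "L-lipschitz_on (ball p0 \<delta>) F"
  shows "\<exists>T>0. \<exists>\<phi>. \<phi> 0 = p0 \<and> ode_solution F D {0..<T} \<phi> \<and>
           (\<forall>T' \<psi>. \<psi> 0 = p0 \<and> ode_solution F D {0..<T'} \<psi> \<longrightarrow> (\<forall>t\<in>{0..<min T T'}. \<psi> t = \<phi> t))"
proof -
  define B where "B = cball p0 (\<delta> / 2)"
  have B: "convex B" "closed B" "B \<noteq> {}" "B \<subseteq> ball p0 \<delta>" using \<open>0 < \<delta>\<close> by (auto simp: B_def)
  have "(L * 1)-lipschitz_on UNIV (\<lambda>x. F (closest_point B x))"
  proof (rule lipschitz_on_compose2[where f = "closest_point B" and g = F])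
    show "1-lipschitz_on UNIV (closest_point B)"
      using closest_point_lipschitz[OF B(1-3)] by (intro lipschitz_onI) auto
    show "L-lipschitz_on (range (closest_point B)) F"
      using closest_point_in_set[OF B(2,3)] B(4) by (intro lipschitz_on_subset[OF lip]) auto
  qed
  from picard_lipschitz[OF this, of p0] obtain T0 \<phi> where T0: "0 < T0" and \<phi>0: "\<phi> 0 = p0"
    and \<phi>: "\<And>t. t \<in> {0..T0} \<Longrightarrow> (\<phi> has_vector_derivative F (closest_point B (\<phi> t))) (at t within {0..T0})"
    by blast
  have "continuous_on {0..T0} \<phi>" using \<phi> by (rule continuous_on_vector_derivative)
  then have "(\<phi> \<longlongrightarrow> p0) (at 0 within {0..T0})" using T0 \<phi>0 by (auto simp: continuous_on_def)
  then have "\<forall>\<^sub>F t in at 0 within {0..T0}. \<phi> t \<in> ball p0 (\<delta> / 2)"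
    using \<open>0 < \<delta>\<close> by (intro topological_tendstoD) auto
  then obtain \<eta> where \<eta>: "0 < \<eta>" "\<And>t. t \<in> {0..T0} \<Longrightarrow> t \<noteq> 0 \<Longrightarrow> dist t 0 < \<eta> \<Longrightarrow> \<phi> t \<in> ball p0 (\<delta> / 2)"
    unfolding eventually_at by blast
  define T where "T = min T0 \<eta>"
  have T: "0 < T" using T0 \<eta>(1) by (simp add: T_def)
  have sub: "{0..<T} \<subseteq> {0..T0}" by (auto simp: T_def)
  have inB: "\<phi> t \<in> B" if "t \<in> {0..<T}" for t
    using that \<eta>(2)[of t] \<phi>0 \<open>0 < \<delta>\<close> by (cases "t = 0") (auto simp: T_def B_def)
  have sol: "(\<phi> has_vector_derivative F (\<phi> t)) (at t within {0..<T})" if t: "t \<in> {0..<T}" for t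
    using has_vector_derivative_within_subset[OF \<phi> sub, of t] t sub inB[OF t]
    by (auto simp: closest_point_self)
  have unique: "\<psi> t = \<phi> t" if \<psi>0: "\<psi> 0 = p0" and \<psi>: "ode_solution F D {0..<T'} \<psi>" and t: "t \<in> {0..<min T T'}"
    for T' \<psi> t
  proof -
    let ?S = "{0..<min T T'}"
    have d\<phi>: "(\<phi> has_vector_derivative F (\<phi> s)) (at s within ?S)" if "s \<in> ?S" for s
      using that by (intro has_vector_derivative_within_subset[OF sol]) auto
    have d\<psi>: "(\<psi> has_vector_derivative F (\<psi> s)) (at s within ?S)" if "s \<in> ?S" for s
    proof (rule has_vector_derivative_within_subset)
      show "(\<psi> has_vector_derivative F (\<psi> s)) (at s within {0..<T'})"
        using that \<psi> by (simp add: ode_solution_def)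
    qed auto
    have cont: "continuous_on ?S \<phi>" "continuous_on ?S \<psi>"
      by (rule continuous_on_vector_derivative, erule d\<phi>) (rule continuous_on_vector_derivative, erule d\<psi>)
    have "(\<phi> 0 = \<psi> 0) = (\<phi> t = \<psi> t)"
    proof (rule connected_local_const[of ?S])
      show "connected ?S" by (intro convex_connected) auto
      show "0 \<in> ?S" "t \<in> ?S" using t by auto
      show "\<forall>s\<in>?S. \<forall>\<^sub>F u in at s within ?S. (\<phi> s = \<psi> s) = (\<phi> u = \<psi> u)"
      proof
        fix s assume s: "s \<in> ?S"
        show "\<forall>\<^sub>F u in at s within ?S. (\<phi> s = \<psi> s) = (\<phi> u = \<psi> u)"
        proof (cases "\<phi> s = \<psi> s")
          case True
          have "\<phi> s \<in> ball p0 \<delta>" using inB[of s] s B(4) by auto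
          from ode_solutions_agree_near[OF lip open_ball _ d\<phi> d\<psi> s True this]
          show ?thesis using True by simp
        next
          case False
          have "((\<lambda>u. \<phi> u - \<psi> u) \<longlongrightarrow> \<phi> s - \<psi> s) (at s within ?S)"
            using cont s by (intro tendsto_intros) (auto simp: continuous_on_def)
          from tendsto_imp_eventually_ne[OF this, of 0] False
          have "\<forall>\<^sub>F u in at s within ?S. \<phi> u - \<psi> u \<noteq> 0" by simp
          then show ?thesis by (rule eventually_mono) (use False in auto)
        qed
      qed
    qed
    then show ?thesis using \<phi>0 \<psi>0 by simp
  qed
  have solution: "ode_solution F D {0..<T} \<phi>"
    unfolding ode_solution_def
  proof (intro ballI conjI)
    fix t assume t: "t \<in> {0..<T}"
    show "\<phi> t \<in> D" using inB[OF t] B(4) D by blast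
    show "(\<phi> has_vector_derivative F (\<phi> t)) (at t within {0..<T})" using t by (rule sol)
  qed
  show ?thesis
  proof (intro exI conjI allI impI ballI)
    fix T' \<psi> t
    assume "\<psi> 0 = p0 \<and> ode_solution F D {0..<T'} \<psi>" and t: "t \<in> {0..<min T T'}"
    then show "\<psi> t = \<phi> t" by (elim conjE) (rule unique)
  qed (fact T \<phi>0 solution)+
qed


section \<open>Gains that work on a compact set\<close>

text \<open>
  If \<open>s p = 0\<close>, then \<open>\<phi>\<close> is positive near \<open>p\<close> and every gain \<open>\<alpha> > 0\<close> will do; if \<open>s p > 0\<close>, then \<open>s\<close> is
  bounded below near \<open>p\<close> and a large gain outweighs \<open>\<phi>\<close>.
\<close>

lemma eventually_dominated:
  fixes \<phi> s :: "'a::topological_space \<Rightarrow> real"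
  assumes \<phi>: "(\<phi> \<longlongrightarrow> \<phi> p) (nhds p)" and s: "(s \<longlongrightarrow> s p) (nhds p)"
    and "0 \<le> s p" and active: "s p = 0 \<Longrightarrow> 0 < \<phi> p"
  shows "\<exists>A. \<forall>\<^sub>F x in nhds p. 0 \<le> s x \<longrightarrow> (\<forall>\<alpha>>A. 0 < \<phi> x + \<alpha> * s x)"
proof (cases "s p = 0")
  case True
  then have "\<forall>\<^sub>F x in nhds p. 0 < \<phi> x" using \<phi> active by (auto intro: order_tendstoD(1))
  then have "\<forall>\<^sub>F x in nhds p. 0 \<le> s x \<longrightarrow> (\<forall>\<alpha>>0. 0 < \<phi> x + \<alpha> * s x)"
    by (rule eventually_mono) (auto intro!: add_pos_nonneg)
  then show ?thesis by (rule exI)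
next
  case False
  with \<open>0 \<le> s p\<close> have pos: "0 < s p" by simp
  define A where "A = 2 * (\<bar>\<phi> p\<bar> + 1) / s p"
  have A0: "0 \<le> A" using pos by (simp add: A_def)
  have "\<forall>\<^sub>F x in nhds p. s p / 2 < s x" using s pos by (intro order_tendstoD(1)) auto
  moreover have "\<forall>\<^sub>F x in nhds p. \<phi> p - 1 < \<phi> x" using \<phi> by (intro order_tendstoD(1)) auto
  ultimately have "\<forall>\<^sub>F x in nhds p. 0 \<le> s x \<longrightarrow> (\<forall>\<alpha>>A. 0 < \<phi> x + \<alpha> * s x)"
  proof eventually_elim
    case (elim x)
    have "0 < \<phi> x + \<alpha> * s x" if "\<alpha> > A" for \<alpha>
    proof -
      have "\<bar>\<phi> p\<bar> + 1 = A * (s p / 2)" using pos by (simp add: A_def)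
      also have "\<dots> \<le> \<alpha> * s x" using that elim(1) A0 pos by (intro mult_mono) auto
      finally show ?thesis using elim(2) by linarith
    qed
    then show ?case by blast
  qed
  then show ?thesis by (rule exI)
qed

lemma compact_uniform_bound:
  fixes R :: "real \<Rightarrow> 'a::topological_space \<Rightarrow> bool"
  assumes "compact C" and mono: "\<And>A B x. A \<le> B \<Longrightarrow> R A x \<Longrightarrow> R B x"
    and loc: "\<And>p. p \<in> C \<Longrightarrow> \<exists>A. \<forall>\<^sub>F x in nhds p. x \<in> C \<longrightarrow> R A x"
  shows "\<exists>A>0. \<forall>x\<in>C. R A x"
proof -
  have "\<forall>p\<in>C. \<exists>A U. open U \<and> p \<in> U \<and> (\<forall>x\<in>U. x \<in> C \<longrightarrow> R A x)"
    using loc unfolding eventually_nhds by blast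
  then obtain A U where U: "\<And>p. p \<in> C \<Longrightarrow> open (U p) \<and> p \<in> U p \<and> (\<forall>x\<in>U p. x \<in> C \<longrightarrow> R (A p) x)"
    by metis
  then have cover: "\<And>p. p \<in> C \<Longrightarrow> open (U p)" "C \<subseteq> (\<Union>p\<in>C. U p)" by blast+
  obtain P where P: "P \<subseteq> C" "finite P" "C \<subseteq> (\<Union>p\<in>P. U p)"
    by (rule compactE_image[OF \<open>compact C\<close> cover])
  have "R (1 + (\<Sum>p\<in>P. \<bar>A p\<bar>)) x" if x: "x \<in> C" for x
  proof -
    obtain p where p: "p \<in> P" "x \<in> U p" using P(3) x by blast
    then have "R (A p) x" using U[of p] P(1) x by blast
    moreover have "\<bar>A p\<bar> \<le> (\<Sum>p\<in>P. \<bar>A p\<bar>)" using p P(2) by (intro member_le_sum) auto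
    ultimately show ?thesis using mono[of "A p" "1 + (\<Sum>p\<in>P. \<bar>A p\<bar>)"] by simp
  qed
  moreover have "0 < 1 + (\<Sum>p\<in>P. \<bar>A p\<bar>)" by (intro add_pos_nonneg sum_nonneg) auto
  ultimately show ?thesis by blast
qed


section \<open>The quadratic program and the closed loop\<close>

text \<open>
  The part of each constraint that does not depend on \<open>q\<close>, so that (SGF) takes the form of a
  projection onto \<open>halfspaces\<close>, see \<open>con_lhs_eq\<close> and \<open>sgf_feasible_set_eq\<close>.
\<close>

fun con_offset ::
  "((real^'n) \<times> (real^'m) \<Rightarrow> real^'n) \<Rightarrow> (real^'n \<Rightarrow> real) \<Rightarrow> real \<Rightarrow> nat \<Rightarrow> (real^'m \<Rightarrow> real)
    \<Rightarrow> real \<Rightarrow> real \<Rightarrow> (real^'n) \<times> (real^'m) \<Rightarrow> sgf_con \<Rightarrow> real" where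
  "con_offset f h \<beta> r b \<alpha> \<gamma> p Input_Con = \<alpha> * b (snd p)"
| "con_offset f h \<beta> r b \<alpha> \<gamma> p State_Con =
     grad_x (h_seq f h \<beta> r) p \<bullet> f p + \<gamma> * h_seq f h \<beta> r p"

definition sgf_target ::
  "(real^'n \<Rightarrow> real) \<Rightarrow> (real^'m \<Rightarrow> real^'n) \<Rightarrow> real \<Rightarrow> (real^'n) \<times> (real^'m) \<Rightarrow> real^'m" where
  "sgf_target \<Phi> w \<epsilon> p = - (\<epsilon> *\<^sub>R (transpose (jacobian w (at (snd p))) *v grad \<Phi> (fst p)))"

lemma UNIV_sgf_con: "UNIV = {Input_Con, State_Con}"
  using sgf_con.exhaust by blast

lemma con_lhs_eq:
  "con_lhs f h \<beta> r b \<alpha> \<gamma> p c q = con_grad f h \<beta> r b p c \<bullet> q + con_offset f h \<beta> r b \<alpha> \<gamma> p c"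
  by (cases c) simp_all

lemma sgf_feasible_set_eq:
  "sgf_feasible_set f h \<beta> r b \<alpha> \<gamma> p =
     halfspaces UNIV (con_grad f h \<beta> r b p) (con_offset f h \<beta> r b \<alpha> \<gamma> p)"
  unfolding sgf_feasible_set_def halfspaces_def UNIV_sgf_con con_lhs_eq by simp

lemma sgf_eq_closest_point:
  assumes "sgf_feasible f h \<beta> r b \<alpha> \<gamma> p"
  shows "sgf f h \<beta> r b \<Phi> w \<epsilon> \<alpha> \<gamma> p =
     closest_point (halfspaces UNIV (con_grad f h \<beta> r b p) (con_offset f h \<beta> r b \<alpha> \<gamma> p))
       (sgf_target \<Phi> w \<epsilon> p)"
proof -
  define K where "K = halfspaces UNIV (con_grad f h \<beta> r b p) (con_offset f h \<beta> r b \<alpha> \<gamma> p)"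
  define d where "d = sgf_target \<Phi> w \<epsilon> p"
  have K: "convex K" "closed K" "K \<noteq> {}"
    using assms
    by (auto simp: K_def convex_halfspaces closed_halfspaces sgf_feasible_def sgf_feasible_set_eq)
  have obj: "sgf_objective \<Phi> w \<epsilon> p q = 1/2 * (dist d q)\<^sup>2" for q
    by (simp add: sgf_objective_def d_def sgf_target_def dist_norm norm_minus_commute add.commute)
  have less: "sgf_objective \<Phi> w \<epsilon> p q < sgf_objective \<Phi> w \<epsilon> p q' \<longleftrightarrow> dist d q < dist d q'" for q q'
    unfolding obj using power_less_imp_less_base[of "dist d q" 2 "dist d q'"]
      power_strict_mono[of "dist d q" "dist d q'" 2] by auto
  have min: "is_arg_min (sgf_objective \<Phi> w \<epsilon> p) (\<lambda>q. q \<in> K) q \<longleftrightarrow>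
      q \<in> K \<and> (\<forall>y\<in>K. dist d q \<le> dist d y)" for q
    unfolding is_arg_min_def less by (auto simp: not_less)
  show ?thesis
    unfolding sgf_def sgf_feasible_set_eq K_def[symmetric] d_def[symmetric] min
  proof (rule the_equality)
    show "closest_point K d \<in> K \<and> (\<forall>y\<in>K. dist d (closest_point K d) \<le> dist d y)"
      using K by (simp add: closest_point_in_set closest_point_le)
    show "q = closest_point K d" if "q \<in> K \<and> (\<forall>y\<in>K. dist d q \<le> dist d y)" for q
      using that K by (intro closest_point_unique) auto
  qed
qed

lemma lipschitz_near_con_grad:
  assumes "Ck 2 (h_seq f h \<beta> r)" "Ck 2 b"
  shows "lipschitz_near (\<lambda>p. con_grad f h \<beta> r b p c) p"
proof (rule Ck_1_imp_lipschitz_near)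
  have "Ck 1 (grad b)" "Ck 1 (grad_u (h_seq f h \<beta> r))"
    using assms by (auto intro!: Ck_grad Ck_grad_u simp: numeral_2_eq_2 simp del: Ck.simps)
  then show "Ck 1 (\<lambda>p. con_grad f h \<beta> r b p c)"
    by (cases c) (simp_all del: Ck.simps One_nat_def add: Ck_compose_linear[OF linear_snd])
qed

lemma lipschitz_near_con_offset:
  assumes "Ck 2 (h_seq f h \<beta> r)" "Ck 2 b" "Ck 1 f"
  shows "lipschitz_near (\<lambda>p. con_offset f h \<beta> r b \<alpha> \<gamma> p c) p"
proof (rule Ck_1_imp_lipschitz_near)
  have 2: "Ck (Suc 1) (h_seq f h \<beta> r)" "Ck (Suc 1) b"
    using assms(1,2) by (simp_all only: numeral_2_eq_2 One_nat_def)
  have 1: "Ck 1 (grad_x (h_seq f h \<beta> r))" "Ck 1 (h_seq f h \<beta> r)" "Ck 1 b"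
    by (fact Ck_grad_x[OF 2(1)] Ck_Suc_imp_Ck[OF 2(1)] Ck_Suc_imp_Ck[OF 2(2)])+
  show "Ck 1 (\<lambda>p. con_offset f h \<beta> r b \<alpha> \<gamma> p c)"
  proof (cases c)
    case Input_Con
    have "Ck 1 (\<lambda>p. \<alpha> * b (snd p))"
      by (intro Ck_bilinear[OF bounded_bilinear_mult] Ck_const Ck_compose_linear[OF linear_snd] 1)
    then show ?thesis using Input_Con by simp
  next
    case State_Con
    have "Ck 1 (\<lambda>p. grad_x (h_seq f h \<beta> r) p \<bullet> f p + \<gamma> * h_seq f h \<beta> r p)"
      by (intro Ck_add Ck_bilinear[OF bounded_bilinear_mult] Ck_bilinear[OF bounded_bilinear_inner]
          Ck_const 1 assms)
    then show ?thesis using State_Con by simp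
  qed
qed

lemma lipschitz_near_sgf_target:
  assumes "Ck 2 \<Phi>" "Ck 2 w"
  shows "lipschitz_near (sgf_target \<Phi> w \<epsilon>) p"
proof (rule Ck_1_imp_lipschitz_near)
  have "Ck 1 (\<lambda>p. (- \<epsilon>) *\<^sub>R (transpose (jacobian w (at (snd p))) *v grad \<Phi> (fst p)))"
    using assms by (intro Ck_bilinear[OF bounded_bilinear_scaleR] Ck_const Ck_jacobian_transpose)
      (simp_all add: numeral_2_eq_2 del: Ck.simps)
  then show "Ck 1 (sgf_target \<Phi> w \<epsilon>)" by (simp add: sgf_target_def[abs_def])
qed

lemma eventually_sgf_feasible:
  assumes "Ck 2 (h_seq f h \<beta> r)" "Ck 2 b" "Ck 1 f"
    and slater: "\<And>c. 0 < con_lhs f h \<beta> r b \<alpha> \<gamma> p c q"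
  shows "\<forall>\<^sub>F x in nhds p. sgf_feasible f h \<beta> r b \<alpha> \<gamma> x"
proof -
  have "\<forall>\<^sub>F x in nhds p. 0 < con_lhs f h \<beta> r b \<alpha> \<gamma> x c q" for c
  proof (rule order_tendstoD(1)[OF _ slater[of c]])
    show "((\<lambda>x. con_lhs f h \<beta> r b \<alpha> \<gamma> x c q) \<longlongrightarrow> con_lhs f h \<beta> r b \<alpha> \<gamma> p c q) (nhds p)"
      unfolding con_lhs_eq
      using lipschitz_near_con_grad[OF assms(1,2)] lipschitz_near_con_offset[OF assms(1-3)]
      by (intro tendsto_intros lipschitz_near_imp_tendsto[where g = "\<lambda>x. con_grad f h \<beta> r b x c"]
          lipschitz_near_imp_tendsto[where g = "\<lambda>x. con_offset f h \<beta> r b \<alpha> \<gamma> x c"])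
  qed
  from this[of Input_Con] this[of State_Con] show ?thesis
  proof eventually_elim
    case (elim x)
    then have "q \<in> sgf_feasible_set f h \<beta> r b \<alpha> \<gamma> x" by (simp add: sgf_feasible_set_def)
    then show ?case unfolding sgf_feasible_def by blast
  qed
qed

lemma lipschitz_near_sgf:
  assumes smooth: "Ck 2 (h_seq f h \<beta> r)" "Ck 2 b" "Ck 1 f" "Ck 2 \<Phi>" "Ck 2 w"
    and slater: "\<And>c. 0 < con_lhs f h \<beta> r b \<alpha> \<gamma> p c q"
    and crcq: "sgf_crcq f h \<beta> r b \<Phi> w \<epsilon> \<alpha> \<gamma> p"
  shows "lipschitz_near (sgf f h \<beta> r b \<Phi> w \<epsilon> \<alpha> \<gamma>) p"
proof -
  let ?a = "\<lambda>c x. con_grad f h \<beta> r b x c" and ?c = "\<lambda>c x. con_offset f h \<beta> r b \<alpha> \<gamma> x c"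
  let ?d = "sgf_target \<Phi> w \<epsilon>"
  let ?A = "{c. con_lhs f h \<beta> r b \<alpha> \<gamma> p c (sgf f h \<beta> r b \<Phi> w \<epsilon> \<alpha> \<gamma> p) = 0}"
  have feas: "\<forall>\<^sub>F x in nhds p. sgf_feasible f h \<beta> r b \<alpha> \<gamma> x"
    using smooth(1-3) slater by (rule eventually_sgf_feasible)
  have "lipschitz_near (\<lambda>x. closest_point (halfspaces UNIV (\<lambda>c. ?a c x) (\<lambda>c. ?c c x)) (?d x)) p"
  proof (rule lipschitz_near_closest_point_constant_rank[where A = ?A and q = q])
    show "finite (UNIV :: sgf_con set)" "card (UNIV :: sgf_con set) \<le> 2"
      by (simp_all add: UNIV_sgf_con)
    show "?A = {c \<in> UNIV. ?a c p \<bullet>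
        closest_point (halfspaces UNIV (\<lambda>c. ?a c p) (\<lambda>c. ?c c p)) (?d p) + ?c c p = 0}"
      unfolding con_lhs_eq sgf_eq_closest_point[OF eventually_nhds_x_imp_x[OF feas]] by simp
    show "\<forall>\<^sub>F x in nhds p. dim ((\<lambda>c. ?a c x) ` J) = dim ((\<lambda>c. ?a c p) ` J)" if "J \<subseteq> ?A" for J
      using crcq that unfolding sgf_crcq_def by blast
    show "0 < ?a c p \<bullet> q + ?c c p" for c using slater[of c] by (simp only: con_lhs_eq)
  qed (intro lipschitz_near_con_grad lipschitz_near_con_offset lipschitz_near_sgf_target smooth)+
  then show ?thesis
    by (rule lipschitz_near_transform)
       (use feas in \<open>auto elim!: eventually_mono simp: sgf_eq_closest_point\<close>)
qed

text \<open>
  The vector \<open>q\<close> given at a point \<open>p\<close> of \<open>C\<close> serves for all points of \<open>C\<close> near \<open>p\<close> as soon as the gains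
  are large, by \<open>eventually_dominated\<close> for each of the two constraints; a finite subcover of \<open>C\<close>
  yields a common threshold. Membership in \<open>C\<close> enters through the signs of the barrier terms
  \<open>b\<close> and \<open>h\<^sub>r\<close>.
\<close>

lemma sgf_uniformly_strictly_feasible:
  assumes smooth: "Ck 2 (h_seq f h \<beta> r)" "Ck 2 b" "Ck 1 f"
    and C: "compact C" "C \<subseteq> safe_seq f h \<beta> b r"
    and inner: "\<And>x u. (x, u) \<in> C \<Longrightarrow>
           \<exists>q. (b u = 0 \<longrightarrow> grad b u \<bullet> q > 0) \<and>
               (h_seq f h \<beta> r (x, u) = 0 \<longrightarrow>
                  grad_u (h_seq f h \<beta> r) (x, u) \<bullet> q
                    + grad_x (h_seq f h \<beta> r) (x, u) \<bullet> f (x, u) > 0)"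
  shows "\<exists>A>0. \<forall>p\<in>C. \<forall>\<alpha>>A. \<forall>\<gamma>>A. \<exists>q. \<forall>c. 0 < con_lhs f h \<beta> r b \<alpha> \<gamma> p c q"
proof (rule compact_uniform_bound[OF C(1)])
  let ?H = "h_seq f h \<beta> r"
  fix p assume p: "p \<in> C"
  have safe: "0 \<le> b (snd x)" "0 \<le> ?H x" if "x \<in> C" for x
    using C(2) that by (auto simp: safe_seq_def)
  obtain q where q: "b (snd p) = 0 \<Longrightarrow> grad b (snd p) \<bullet> q > 0"
    "?H p = 0 \<Longrightarrow> grad_u ?H p \<bullet> q + grad_x ?H p \<bullet> f p > 0"
    using inner[of "fst p" "snd p"] p by auto
  have cont: "((\<lambda>x. con_grad f h \<beta> r b x c) \<longlongrightarrow> con_grad f h \<beta> r b p c) (nhds p)"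
    "((\<lambda>x. con_offset f h \<beta> r b \<alpha> \<gamma> x c) \<longlongrightarrow> con_offset f h \<beta> r b \<alpha> \<gamma> p c) (nhds p)" for c \<alpha> \<gamma>
    using lipschitz_near_con_grad[OF smooth(1,2), of c p]
      lipschitz_near_con_offset[OF smooth, of \<alpha> \<gamma> c p]
    by (auto dest: lipschitz_near_imp_tendsto)
  \<comment> \<open>Suitable gains isolate \<open>b\<close> and \<open>h\<^sub>r\<close> in the offsets, whose continuity is known.\<close>
  have cont_b: "((\<lambda>x. b (snd x)) \<longlongrightarrow> b (snd p)) (nhds p)"
    using cont(2)[of 1 0 Input_Con] by simp
  have cont_H: "(?H \<longlongrightarrow> ?H p) (nhds p)"
    using tendsto_diff[OF cont(2)[of 0 1 State_Con] cont(2)[of 0 0 State_Con]] by simp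
  have "\<exists>A. \<forall>\<^sub>F x in nhds p. 0 \<le> b (snd x) \<longrightarrow> (\<forall>\<alpha>>A. 0 < grad b (snd x) \<bullet> q + \<alpha> * b (snd x))"
    using cont(1)[of Input_Con] cont_b safe[OF p] q(1)
    by (intro eventually_dominated[where s = "\<lambda>x. b (snd x)"] tendsto_intros) auto
  then obtain A1 where A1: "\<forall>\<^sub>F x in nhds p. 0 \<le> b (snd x) \<longrightarrow>
      (\<forall>\<alpha>>A1. 0 < grad b (snd x) \<bullet> q + \<alpha> * b (snd x))" by (elim exE) (rule that)
  have cont_\<phi>: "((\<lambda>x. grad_u ?H x \<bullet> q + grad_x ?H x \<bullet> f x)
      \<longlongrightarrow> grad_u ?H p \<bullet> q + grad_x ?H p \<bullet> f p) (nhds p)"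
    using tendsto_add[OF tendsto_inner[OF cont(1)[of State_Con] tendsto_const] cont(2)[of 0 0 State_Con]]
    by simp
  have "\<exists>A. \<forall>\<^sub>F x in nhds p. 0 \<le> ?H x \<longrightarrow>
      (\<forall>\<gamma>>A. 0 < (grad_u ?H x \<bullet> q + grad_x ?H x \<bullet> f x) + \<gamma> * ?H x)"
    using cont_\<phi> cont_H safe(2)[OF p] q(2) by (rule eventually_dominated)
  then obtain A2 where A2: "\<forall>\<^sub>F x in nhds p. 0 \<le> ?H x \<longrightarrow>
      (\<forall>\<gamma>>A2. 0 < (grad_u ?H x \<bullet> q + grad_x ?H x \<bullet> f x) + \<gamma> * ?H x)" by (elim exE) (rule that)
  have "\<forall>\<^sub>F x in nhds p. x \<in> C \<longrightarrow>
      (\<forall>\<alpha>>max A1 A2. \<forall>\<gamma>>max A1 A2. \<exists>q. \<forall>c. 0 < con_lhs f h \<beta> r b \<alpha> \<gamma> x c q)"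
    using A1 A2
  proof eventually_elim
    case (elim x)
    have "0 < con_lhs f h \<beta> r b \<alpha> \<gamma> x c q" if "x \<in> C" "\<alpha> > max A1 A2" "\<gamma> > max A1 A2" for \<alpha> \<gamma> c
      using elim safe[OF that(1)] that(2,3) by (cases c) (auto simp: algebra_simps)
    then show ?case by blast
  qed
  then show "\<exists>A. \<forall>\<^sub>F x in nhds p. x \<in> C \<longrightarrow>
      (\<forall>\<alpha>>A. \<forall>\<gamma>>A. \<exists>q. \<forall>c. 0 < con_lhs f h \<beta> r b \<alpha> \<gamma> x c q)" by (rule exI)
next
  fix A B :: real and x
  assume "A \<le> B" and R: "\<forall>\<alpha>>A. \<forall>\<gamma>>A. \<exists>q. \<forall>c. 0 < con_lhs f h \<beta> r b \<alpha> \<gamma> x c q"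
  show "\<forall>\<alpha>>B. \<forall>\<gamma>>B. \<exists>q. \<forall>c. 0 < con_lhs f h \<beta> r b \<alpha> \<gamma> x c q"
    by (intro allI impI R[rule_format] le_less_trans[OF \<open>A \<le> B\<close>])
qed

lemma sgf_cl_unique_solution_if_lipschitz:
  assumes "Ck 1 f" and lip: "lipschitz_near (sgf f h \<beta> r b \<Phi> w \<epsilon> \<alpha> \<gamma>) p"
    and feas: "\<forall>\<^sub>F x in nhds p. sgf_feasible f h \<beta> r b \<alpha> \<gamma> x"
  shows "sgf_cl_unique_solution f h \<beta> r b \<Phi> w \<epsilon> \<alpha> \<gamma> p"
proof -
  obtain \<delta>1 L1 where 1: "\<delta>1 > 0" "L1-lipschitz_on (ball p \<delta>1) f"
    using Ck_1_imp_lipschitz_near[OF \<open>Ck 1 f\<close>] unfolding lipschitz_near_iff_ball by blast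
  obtain \<delta>2 L2 where 2: "\<delta>2 > 0" "L2-lipschitz_on (ball p \<delta>2) (sgf f h \<beta> r b \<Phi> w \<epsilon> \<alpha> \<gamma>)"
    using lip unfolding lipschitz_near_iff_ball by blast
  obtain \<delta>3 where 3: "\<delta>3 > 0" "\<And>x. dist x p < \<delta>3 \<Longrightarrow> sgf_feasible f h \<beta> r b \<alpha> \<gamma> x"
    using feas unfolding eventually_nhds_metric by blast
  define \<delta> where "\<delta> = min \<delta>1 (min \<delta>2 \<delta>3)"
  have "(sqrt (L1\<^sup>2 + L2\<^sup>2))-lipschitz_on (ball p \<delta>) (\<lambda>x. (f x, sgf f h \<beta> r b \<Phi> w \<epsilon> \<alpha> \<gamma> x))"
    by (intro lipschitz_on_Pair lipschitz_on_subset[OF 1(2)] lipschitz_on_subset[OF 2(2)])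
       (auto simp: \<delta>_def)
  moreover have "0 < \<delta>" using 1 2 3 by (simp add: \<delta>_def)
  moreover have "ball p \<delta> \<subseteq> {x. sgf_feasible f h \<beta> r b \<alpha> \<gamma> x}"
    using 3(2) by (auto simp: \<delta>_def dist_commute)
  ultimately show ?thesis
    unfolding sgf_cl_unique_solution_def sgf_cl_solution_def conj_assoc
    by (intro ode_unique_solution)
qed

theorem mainTheorem2:
  fixes f :: "(real^'n) \<times> (real^'m) \<Rightarrow> real^'n"
    and \<Phi> h :: "real^'n \<Rightarrow> real"
    and b :: "real^'m \<Rightarrow> real"
    and w :: "real^'m \<Rightarrow> real^'n"
    and \<beta> \<epsilon> :: real
    and r :: nat
    and C :: "((real^'n) \<times> (real^'m)) set"
  assumes "\<beta> > 0"
    and w_equilibrium: "\<And>u. globally_exp_stable_equilibrium (\<lambda>x. f (x, u)) (w u)"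
    and w_unique: "\<And>u x. globally_exp_stable_equilibrium (\<lambda>x. f (x, u)) x \<Longrightarrow> x = w u"
    and "r \<ge> 1"
    and "Ck (r + 1) f"
    and "Ck (r + 2) h"
    and "safe_seq f h \<beta> b r \<noteq> {}"
    and "\<And>p. p \<in> safe_seq f h \<beta> b r \<Longrightarrow> h_seq f h \<beta> r p = 0 \<Longrightarrow> grad_u (h_seq f h \<beta> r) p \<noteq> 0"
    and "\<And>p i. p \<in> safe_seq f h \<beta> b r \<Longrightarrow> i < r \<Longrightarrow> grad_u (h_seq f h \<beta> i) p = 0"
    and "Ck 2 b"
    and "\<And>x u. (x, u) \<in> safe_set h b \<Longrightarrow> b u = 0 \<Longrightarrow> grad b u \<noteq> 0"
    and "Ck 2 \<Phi>"
    and "Ck 2 w"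
    and "\<epsilon> > 0"
    and "compact C"
    and "C \<subseteq> safe_seq f h \<beta> b r"
    and "\<And>x u. (x, u) \<in> C \<Longrightarrow>
           \<exists>q. (b u = 0 \<longrightarrow> grad b u \<bullet> q > 0) \<and>
               (h_seq f h \<beta> r (x, u) = 0 \<longrightarrow>
                  grad_u (h_seq f h \<beta> r) (x, u) \<bullet> q
                    + grad_x (h_seq f h \<beta> r) (x, u) \<bullet> f (x, u) > 0)"
  shows "\<exists>\<alpha>\<^sub>f>0. \<exists>\<gamma>\<^sub>f>0. \<forall>\<alpha>>\<alpha>\<^sub>f. \<forall>\<gamma>>\<gamma>\<^sub>f.
           (\<forall>p\<in>C. sgf_feasible f h \<beta> r b \<alpha> \<gamma> p) \<and>
           ((\<forall>p\<in>C. sgf_crcq f h \<beta> r b \<Phi> w \<epsilon> \<alpha> \<gamma> p) \<longrightarrow>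
              sgf_locally_lipschitz_in f h \<beta> r b \<Phi> w \<epsilon> \<alpha> \<gamma> C \<and>
              (\<forall>p\<in>C. sgf_cl_unique_solution f h \<beta> r b \<Phi> w \<epsilon> \<alpha> \<gamma> p))"
proof -
  have H: "Ck 2 (h_seq f h \<beta> r)"
    using Ck_h_seq[OF \<open>Ck (r + 1) f\<close> \<open>Ck (r + 2) h\<close> order_refl, of \<beta>] by simp
  have f1: "Ck 1 f" using \<open>Ck (r + 1) f\<close> by (rule Ck_mono) simp
  obtain A where "A > 0" and A: "\<And>p \<alpha> \<gamma>. p \<in> C \<Longrightarrow> \<alpha> > A \<Longrightarrow> \<gamma> > A \<Longrightarrow>
      \<exists>q. \<forall>c. 0 < con_lhs f h \<beta> r b \<alpha> \<gamma> p c q"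
    using sgf_uniformly_strictly_feasible[OF H \<open>Ck 2 b\<close> f1 \<open>compact C\<close>
        \<open>C \<subseteq> safe_seq f h \<beta> b r\<close> assms(17)] by blast
  have main: "(\<forall>p\<in>C. sgf_feasible f h \<beta> r b \<alpha> \<gamma> p) \<and>
           ((\<forall>p\<in>C. sgf_crcq f h \<beta> r b \<Phi> w \<epsilon> \<alpha> \<gamma> p) \<longrightarrow>
              sgf_locally_lipschitz_in f h \<beta> r b \<Phi> w \<epsilon> \<alpha> \<gamma> C \<and>
              (\<forall>p\<in>C. sgf_cl_unique_solution f h \<beta> r b \<Phi> w \<epsilon> \<alpha> \<gamma> p))"
    if large: "\<alpha> > A" "\<gamma> > A" for \<alpha> \<gamma>
  proof -
    have feas: "\<forall>\<^sub>F x in nhds p. sgf_feasible f h \<beta> r b \<alpha> \<gamma> x" if "p \<in> C" for p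
      using A[OF that large] eventually_sgf_feasible[OF H \<open>Ck 2 b\<close> f1] by blast
    have lip: "lipschitz_near (sgf f h \<beta> r b \<Phi> w \<epsilon> \<alpha> \<gamma>) p"
      if "p \<in> C" "sgf_crcq f h \<beta> r b \<Phi> w \<epsilon> \<alpha> \<gamma> p" for p
      using A[OF that(1) large] lipschitz_near_sgf[OF H \<open>Ck 2 b\<close> f1 \<open>Ck 2 \<Phi>\<close> \<open>Ck 2 w\<close> _ that(2)]
      by blast
    show ?thesis
    proof (intro conjI impI ballI)
      fix p assume "p \<in> C"
      then show "sgf_feasible f h \<beta> r b \<alpha> \<gamma> p" by (rule eventually_nhds_x_imp_x[OF feas])
    next
      fix p assume crcq: "\<forall>p\<in>C. sgf_crcq f h \<beta> r b \<Phi> w \<epsilon> \<alpha> \<gamma> p" and p: "p \<in> C"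
      then show "sgf_cl_unique_solution f h \<beta> r b \<Phi> w \<epsilon> \<alpha> \<gamma> p"
        using sgf_cl_unique_solution_if_lipschitz[OF f1 lip feas] by blast
    next
      assume crcq: "\<forall>p\<in>C. sgf_crcq f h \<beta> r b \<Phi> w \<epsilon> \<alpha> \<gamma> p"
      show "sgf_locally_lipschitz_in f h \<beta> r b \<Phi> w \<epsilon> \<alpha> \<gamma> C"
        unfolding sgf_locally_lipschitz_in_def
      proof
        fix p assume p: "p \<in> C"
        obtain \<delta>1 L where 1: "\<delta>1 > 0" "L-lipschitz_on (ball p \<delta>1) (sgf f h \<beta> r b \<Phi> w \<epsilon> \<alpha> \<gamma>)"
          using lip[OF p] crcq p unfolding lipschitz_near_iff_ball by blast
        obtain \<delta>2 where 2: "\<delta>2 > 0" "\<And>x. dist x p < \<delta>2 \<Longrightarrow> sgf_feasible f h \<beta> r b \<alpha> \<gamma> x"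
          using feas[OF p] unfolding eventually_nhds_metric by blast
        have "L-lipschitz_on (ball p (min \<delta>1 \<delta>2)) (sgf f h \<beta> r b \<Phi> w \<epsilon> \<alpha> \<gamma>)"
          by (rule lipschitz_on_subset[OF 1(2)]) auto
        then show "\<exists>\<delta>>0. (\<forall>p'\<in>ball p \<delta>. sgf_feasible f h \<beta> r b \<alpha> \<gamma> p') \<and>
            (\<exists>L. L-lipschitz_on (ball p \<delta>) (sgf f h \<beta> r b \<Phi> w \<epsilon> \<alpha> \<gamma>))"
          using 1(1) 2 by (intro exI[of _ "min \<delta>1 \<delta>2"]) (auto simp: dist_commute)
      qed
    qed
  qed
  show ?thesis
    by (intro exI[of _ A] conjI allI impI \<open>A > 0\<close> main)
qed

end
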